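(* For any given rooted tree $L$, the proportion of $n$-vertex rooted trees that have $L$ as a maximal limb approaches $1$ as $n\to\infty$.
   Context: Rooted trees are finite and are counted up to root-preserving isomorphism. For a rooted tree $T$ and a vertex $v$ of $T$, the maximal limb at $v$ is the rooted subtree of $T$ with root $v$ consisting of $v$ and all descendants of $v$. The tree $T$ has $L$ as a maximal limb if for some vertex $v$ of $T$ the maximal limb at $v$ is isomorphic to $L$ as a rooted tree. *)

theory Defs
  imports Complex_Main "Graph_Theory.Digraph_Component"
begin

text \<open>
  A rooted graph is a pair of a graph and a vertex. Graphs are the finite simple graphs
  \<open>pair_graph\<close>, whose edges are stored as symmetric sets of ordered pairs. The constant
  \<open>tree\<close> of the digraph library only forbids directed cycles, and in a symmetric
  digraph every edge gives a directed cycle of length 2. Acyclicity is therefore stated here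
  for cycles of length at least 3, which are the cycles of the undirected graph.
\<close>

type_synonym 'a rooted_graph = "'a pair_pre_digraph \<times> 'a"

definition rooted_tree :: "'a rooted_graph \<Rightarrow> bool" where
  "rooted_tree T \<longleftrightarrow>
     pair_graph (fst T) \<and>
     Digraph_Component.connected (with_proj (fst T)) \<and>
     (\<nexists>c. pre_digraph.cycle (with_proj (fst T)) c \<and> 3 \<le> length c) \<and>
     snd T \<in> pverts (fst T)"

definition rooted_iso :: "'a rooted_graph \<Rightarrow> 'b rooted_graph \<Rightarrow> bool" where
  "rooted_iso S T \<longleftrightarrow>
     (\<exists>f. bij_betw f (pverts (fst S)) (pverts (fst T)) \<and>
          (\<forall>u \<in> pverts (fst S). \<forall>v \<in> pverts (fst S).
             (u, v) \<in> parcs (fst S) \<longleftrightarrow> (f u, f v) \<in> parcs (fst T)) \<and>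
          f (snd S) = snd T)"

text \<open>
  The vertex \<open>v\<close> together with all its descendants: the vertices \<open>w\<close> such that \<open>v\<close> lies on
  the path (without repeated vertices, unique in a tree) from the root to \<open>w\<close>.
\<close>

definition limb_verts :: "'a rooted_graph \<Rightarrow> 'a \<Rightarrow> 'a set" where
  "limb_verts T v =
     {w. \<exists>p. pre_digraph.apath (with_proj (fst T)) (snd T) p w \<and>
             v \<in> set (pre_digraph.awalk_verts (with_proj (fst T)) (snd T) p)}"

definition maximal_limb :: "'a rooted_graph \<Rightarrow> 'a \<Rightarrow> 'a rooted_graph" where
  "maximal_limb T v =
     (\<lparr> pverts = limb_verts T v,
        parcs = {e \<in> parcs (fst T). fst e \<in> limb_verts T v \<and> snd e \<in> limb_verts T v} \<rparr>, v)"

definition has_maximal_limb :: "'a rooted_graph \<Rightarrow> 'b rooted_graph \<Rightarrow> bool" where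
  "has_maximal_limb T L \<longleftrightarrow> (\<exists>v \<in> pverts (fst T). rooted_iso (maximal_limb T v) L)"

text \<open>
  Every finite rooted tree is isomorphic to one whose vertices are natural numbers, so
  isomorphism classes are counted among the latter.
\<close>

definition rooted_iso_rel :: "(nat rooted_graph \<times> nat rooted_graph) set" where
  "rooted_iso_rel = {(S, T). rooted_tree S \<and> rooted_tree T \<and> rooted_iso S T}"

definition rooted_trees :: "nat \<Rightarrow> nat rooted_graph set" where
  "rooted_trees n = {T. rooted_tree T \<and> card (pverts (fst T)) = n}"

definition num_rooted_trees :: "nat \<Rightarrow> nat" where
  "num_rooted_trees n = card (rooted_trees n // rooted_iso_rel)"

definition num_rooted_trees_with_limb :: "'a rooted_graph \<Rightarrow> nat \<Rightarrow> nat" where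
  "num_rooted_trees_with_limb L n =
     card ({T \<in> rooted_trees n. has_maximal_limb T L} // rooted_iso_rel)"

lemma rooted_iso_refl: "rooted_iso S S"
  unfolding rooted_iso_def by (intro exI[of _ id]) auto

lemma rooted_iso_sym:
  assumes "rooted_tree S" "rooted_iso S T"
  shows "rooted_iso T S"
proof -
  obtain f where f: "bij_betw f (pverts (fst S)) (pverts (fst T))"
      "\<And>u v. \<lbrakk>u \<in> pverts (fst S); v \<in> pverts (fst S)\<rbrakk> \<Longrightarrow>
         (u, v) \<in> parcs (fst S) \<longleftrightarrow> (f u, f v) \<in> parcs (fst T)"
      "f (snd S) = snd T"
    using assms(2) unfolding rooted_iso_def by blast
  let ?g = "the_inv_into (pverts (fst S)) f"
  have inj: "inj_on f (pverts (fst S))" and im: "f ` pverts (fst S) = pverts (fst T)"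
    using f(1) by (auto simp: bij_betw_def)
  have g: "?g v \<in> pverts (fst S)" "f (?g v) = v" if "v \<in> pverts (fst T)" for v
    using that inj im by (auto intro: the_inv_into_into f_the_inv_into_f)
  have root: "?g (snd T) = snd S"
    using assms(1) f(3) inj the_inv_into_f_f[OF inj, of "snd S"]
    by (simp add: rooted_tree_def)
  show ?thesis
    unfolding rooted_iso_def
    using bij_betw_the_inv_into[OF f(1)] root f(2) g by (intro exI[of _ ?g]) auto
qed

lemma rooted_iso_trans:
  assumes "rooted_iso S T" "rooted_iso T U"
  shows "rooted_iso S U"
proof -
  obtain f where f: "bij_betw f (pverts (fst S)) (pverts (fst T))"
      "\<And>u v. \<lbrakk>u \<in> pverts (fst S); v \<in> pverts (fst S)\<rbrakk> \<Longrightarrow>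
         (u, v) \<in> parcs (fst S) \<longleftrightarrow> (f u, f v) \<in> parcs (fst T)"
      "f (snd S) = snd T"
    using assms(1) unfolding rooted_iso_def by blast
  obtain g where g: "bij_betw g (pverts (fst T)) (pverts (fst U))"
      "\<And>u v. \<lbrakk>u \<in> pverts (fst T); v \<in> pverts (fst T)\<rbrakk> \<Longrightarrow>
         (u, v) \<in> parcs (fst T) \<longleftrightarrow> (g u, g v) \<in> parcs (fst U)"
      "g (snd T) = snd U"
    using assms(2) unfolding rooted_iso_def by blast
  have "f u \<in> pverts (fst T)" if "u \<in> pverts (fst S)" for u
    using that f(1) by (auto simp: bij_betw_def)
  then show ?thesis
    unfolding rooted_iso_def
    using bij_betw_trans[OF f(1) g(1)] f(2,3) g(2,3) by (intro exI[of _ "g \<circ> f"]) auto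
qed

lemma equiv_rooted_iso_rel: "equiv {T. rooted_tree T} rooted_iso_rel"
proof (rule equivI)
  show "rooted_iso_rel \<subseteq> {T. rooted_tree T} \<times> {T. rooted_tree T}"
    by (auto simp: rooted_iso_rel_def)
  show "refl_on {T. rooted_tree T} rooted_iso_rel"
    by (auto simp: refl_on_def rooted_iso_rel_def rooted_iso_refl)
  show "sym rooted_iso_rel"
    by (auto simp: sym_def rooted_iso_rel_def dest: rooted_iso_sym)
  show "trans rooted_iso_rel"
    unfolding trans_def rooted_iso_rel_def using rooted_iso_trans by blast
qed

end

theory Submission
  imports Defs "HOL-Library.Multiset" "HOL-Library.FuncSet" "HOL-Library.Disjoint_Sets"
    "HOL-Library.Nat_Bijection"
begin

text \<open>
  An isomorphism class of rooted trees is the same as a tree whose root carries the multiset of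
  the limbs at its children. Let \<open>T\<close> be the generating function of all rooted trees by number of
  vertices, \<open>A\<close> that of the trees without limb \<open>L\<close>, where \<open>L\<close> has \<open>l\<close> vertices, and \<open>\<rho>\<close> the
  radius of convergence of \<open>T\<close>. A marked-vertex count gives
  \<open>x T'(x) \<ge> T(x) + T(x) x T'(x)\<close>, so \<open>T(x) < 1\<close> below \<open>\<rho>\<close> and \<open>T(\<rho>) \<le> 1\<close>. The trees whose
  children all avoid \<open>L\<close> are \<open>L\<close> itself and the trees avoiding \<open>L\<close>; therefore
  \<open>A(x) + x\<^sup>l = x \<Prod> 1 / (1 - x\<^sup>k)\<close>, the product running over the trees avoiding \<open>L\<close> with \<open>k\<close> their
  numbers of vertices. Up to factors that stay regular at \<open>\<rho>\<close> the right-hand side is \<open>x exp A(x)\<close>,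
  whose derivative in \<open>A\<close> at \<open>\<rho>\<close> is \<open>A(\<rho>) + \<rho>\<^sup>l < T(\<rho>) \<le> 1\<close>. This lets \<open>A\<close> converge beyond
  \<open>\<rho>\<close>, so trees avoiding \<open>L\<close> are exponentially rare.
\<close>

section \<open>Trees as nested multisets\<close>

text \<open>The nature of the singularity of \<open>T\<close> at \<rho> is never analysed.
  Everything is phrased through the polynomials \<open>partial_gf S N x\<close> and bounds uniform
  in \<open>N\<close>; \<rho> is a supremum of points where such a bound holds, and the growth of
  the terms beyond it is derived afterwards. The functional equation enters only as two
  inequalities: an upper one that passes from \<open>N\<close> to \<open>Suc N\<close> beyond
  \<rho>, and a lower one at \<rho> itself. The room for going beyond \<rho> comes from one extra
  tree: the root with \<open>L\<close> as its only child is neither \<open>L\<close> nor avoids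
  \<open>L\<close>, so A(\<rho>) + \<open>\<rho> ^ l\<close> stays below 1 by at least
  \<open>\<rho> ^ Suc l\<close>. A bound on \<open>A\<close> beyond \<rho> is not enough, since the
  total counts must be large for every large n and not only along a subsequence; joining two trees
  under a new root propagates one large term to all later indices. The graph side rests on orienting
  a tree away from its root: the parent-child relation links vertex sets, limbs and isomorphisms to
  nested multisets.\<close>

datatype rtree = Node (children: "rtree multiset")

primrec nverts :: "rtree \<Rightarrow> nat" where
  "nverts (Node M) = Suc (sum_mset (image_mset nverts M))"

primrec limbs :: "rtree \<Rightarrow> rtree set" where
  "limbs (Node M) = insert (Node M) (\<Union> (set_mset (image_mset limbs M)))"

lemma nverts_pos [simp]: "0 < nverts t"
  by (cases t) simp

lemma nverts_neq_0 [simp]: "nverts t \<noteq> 0"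
  by (cases t) simp

lemma self_in_limbs: "t \<in> limbs t"
  by (cases t) simp

lemma nverts_child_less: "c \<in># M \<Longrightarrow> nverts c < nverts (Node M)"
  by (auto dest!: multi_member_split)

lemma nverts_limb_le: "l \<in> limbs t \<Longrightarrow> nverts l \<le> nverts t"
proof (induction t)
  case (Node M)
  then show ?case
    using nverts_child_less[of _ M] by (force intro: less_imp_le)
qed

lemma count_le_nverts: "count M c < nverts (Node M)"
proof -
  have "count M c \<le> size M" by (rule count_le_size)
  also have "size M \<le> (\<Sum>c\<in>#M. nverts c)"
  proof (induction M)
    case (add x M)
    have "1 \<le> nverts x" by (simp add: Suc_le_eq)
    with add show ?case by simp
  qed simp
  finally show ?thesis by simp
qed

lemma nverts_Node_sum:
  assumes "finite F" "set_mset M \<subseteq> F"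
  shows "nverts (Node M) = Suc (\<Sum>c\<in>F. count M c * nverts c)"
  using assms(2)
proof (induction M)
  case (add x M)
  have "(\<Sum>c\<in>F. count (add_mset x M) c * nverts c)
      = (\<Sum>c\<in>F. count M c * nverts c + (if c = x then nverts c else 0))"
    by (rule sum.cong) auto
  with add assms(1) show ?case
    by (simp add: sum.distrib)
qed simp

text \<open>The cap on multiplicities keeps the set finite, so that expanding a product of truncated
  geometric series is an exact identity between finite sums.\<close>

definition bounded_trees :: "rtree set \<Rightarrow> nat \<Rightarrow> rtree set" where
  "bounded_trees F m = {Node M |M. set_mset M \<subseteq> F \<and> (\<forall>c. count M c \<le> m)}"

text \<open>A tree in this set is a free choice of one multiplicity per element of \<open>F\<close>.
  The inverse restricts \<open>count M\<close> to \<open>F\<close> because members of the function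
  space must be \<open>undefined\<close> elsewhere.\<close>

lemma bij_betw_bounded_trees:
  assumes "finite F"
  shows "bij_betw (\<lambda>g. Node (\<Sum>c\<in>F. replicate_mset (g c) c)) (F \<rightarrow>\<^sub>E {..m}) (bounded_trees F m)"
proof (rule bij_betw_byWitness[where f' = "\<lambda>t. case t of Node M \<Rightarrow> restrict (count M) F"])
  have count: "count (\<Sum>c\<in>F. replicate_mset (g c) c) d = (if d \<in> F then g d else 0)" for g d
    using assms by (induction F) auto
  have set: "set_mset (\<Sum>c\<in>F. replicate_mset (g c) c) \<subseteq> F" for g
  proof
    fix c assume "c \<in># (\<Sum>c\<in>F. replicate_mset (g c) c)"
    then have "count (\<Sum>c\<in>F. replicate_mset (g c) c) c \<noteq> 0" by simp
    then show "c \<in> F" unfolding count by (simp split: if_splits)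
  qed
  show "\<forall>g\<in>F \<rightarrow>\<^sub>E {..m}.
      (case Node (\<Sum>c\<in>F. replicate_mset (g c) c) of Node M \<Rightarrow> restrict (count M) F) = g"
    by (auto simp: count fun_eq_iff PiE_def extensional_def)
  show "(\<lambda>g. Node (\<Sum>c\<in>F. replicate_mset (g c) c)) ` (F \<rightarrow>\<^sub>E {..m}) \<subseteq> bounded_trees F m"
    using set by (auto simp: bounded_trees_def count PiE_def Pi_def)
  show "\<forall>t\<in>bounded_trees F m. Node (\<Sum>c\<in>F. replicate_mset
      ((case t of Node M \<Rightarrow> restrict (count M) F) c) c) = t"
    by (auto simp: bounded_trees_def multiset_eq_iff count intro!: count_eq_zero_iff[THEN iffD2])
  show "(\<lambda>t. case t of Node M \<Rightarrow> restrict (count M) F) ` bounded_trees F m \<subseteq> F \<rightarrow>\<^sub>E {..m}"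
    by (auto simp: bounded_trees_def)
qed

lemma finite_bounded_trees: "finite F \<Longrightarrow> finite (bounded_trees F m)"
  using bij_betw_finite[OF bij_betw_bounded_trees] by (auto intro: finite_PiE)

lemma sum_bounded_trees:
  fixes x :: real
  assumes "finite F"
  shows "(\<Sum>t\<in>bounded_trees F m. x ^ nverts t) = x * (\<Prod>c\<in>F. \<Sum>i\<le>m. (x ^ nverts c) ^ i)"
proof -
  have "(\<Sum>t\<in>bounded_trees F m. x ^ nverts t)
      = (\<Sum>g\<in>F \<rightarrow>\<^sub>E {..m}. x ^ nverts (Node (\<Sum>c\<in>F. replicate_mset (g c) c)))"
    by (rule sum.reindex_bij_betw[OF bij_betw_bounded_trees[OF assms], symmetric])
  also have "\<dots> = (\<Sum>g\<in>F \<rightarrow>\<^sub>E {..m}. x * (\<Prod>c\<in>F. (x ^ nverts c) ^ g c))"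
  proof (rule sum.cong[OF refl])
    fix g assume "g \<in> F \<rightarrow>\<^sub>E {..m}"
    have "(\<Sum>d\<in>#(\<Sum>c\<in>F. replicate_mset (g c) c). nverts d) = (\<Sum>c\<in>F. g c * nverts c)"
      using assms by (induction F) auto
    then have "nverts (Node (\<Sum>c\<in>F. replicate_mset (g c) c)) = Suc (\<Sum>c\<in>F. g c * nverts c)"
      by simp
    then show "x ^ nverts (Node (\<Sum>c\<in>F. replicate_mset (g c) c)) = x * (\<Prod>c\<in>F. (x ^ nverts c) ^ g c)"
      by (simp add: power_sum power_mult[symmetric] mult.commute)
  qed
  also have "\<dots> = x * (\<Prod>c\<in>F. \<Sum>i\<le>m. (x ^ nverts c) ^ i)"
    by (subst prod_sum_PiE) (use assms in \<open>auto simp: sum_distrib_left\<close>)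
  finally show ?thesis .
qed

text \<open>The budget of \<open>n\<close> vertices below the root limits both the size of each
  child and how often it can occur, so the two bounds in \<open>bounded_trees\<close> lose no tree
  of this size.\<close>

lemma children_bounded_trees:
  assumes "set_mset M \<subseteq> S" "nverts (Node M) \<le> Suc n"
  shows "Node M \<in> bounded_trees {c \<in> S. nverts c \<le> n} n"
proof -
  have "c \<in> {c \<in> S. nverts c \<le> n}" if "c \<in># M" for c
    using that assms nverts_child_less[OF that] by auto
  moreover have "count M c \<le> n" for c
    using assms(2) count_le_nverts[of M c] by simp
  ultimately show ?thesis
    unfolding bounded_trees_def by blast
qed

lemma finite_nverts_le: "finite {t. nverts t \<le> n}"
proof (induction n)
  case 0
  then show ?case by simp
next
  case (Suc n)
  have "{t. nverts t \<le> Suc n} \<subseteq> bounded_trees {t \<in> UNIV. nverts t \<le> n} n"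
  proof
    fix t assume "t \<in> {t. nverts t \<le> Suc n}"
    then show "t \<in> bounded_trees {t \<in> UNIV. nverts t \<le> n} n"
      using children_bounded_trees[of "children t" UNIV n] by simp
  qed
  then show ?case using finite_bounded_trees Suc by (auto intro: finite_subset)
qed

lemma finite_trees_le: "finite {t \<in> S. nverts t \<le> n}"
  using finite_nverts_le[of n] by (rule finite_subset[rotated]) auto

lemma finite_trees_eq: "finite {t \<in> S. nverts t = n}"
  using finite_nverts_le[of n] by (rule finite_subset[rotated]) auto

section \<open>Counting sequences, partial generating functions and product bounds\<close>

definition tree_count :: "rtree set \<Rightarrow> nat \<Rightarrow> nat" where
  "tree_count S n = card {t \<in> S. nverts t = n}"

text \<open>Indexing by trees instead of by coefficients lets these sums be matched term by term
  with products over trees; \<open>partial_gf_eq\<close> recovers the power series form.\<close>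

definition partial_gf :: "rtree set \<Rightarrow> nat \<Rightarrow> real \<Rightarrow> real" where
  "partial_gf S N x = (\<Sum>t | t \<in> S \<and> nverts t \<le> N. x ^ nverts t)"

lemma partial_gf_eq: "partial_gf S N x = (\<Sum>n\<le>N. real (tree_count S n) * x ^ n)"
proof -
  have "(\<Sum>n\<le>N. real (tree_count S n) * x ^ n)
      = (\<Sum>n\<le>N. \<Sum>t | t \<in> {t \<in> S. nverts t \<le> N} \<and> nverts t = n. x ^ nverts t)"
  proof (rule sum.cong[OF refl])
    fix n assume "n \<in> {..N}"
    then have "{t \<in> {t \<in> S. nverts t \<le> N}. nverts t = n} = {t \<in> S. nverts t = n}" by auto
    then show "real (tree_count S n) * x ^ n
        = (\<Sum>t | t \<in> {t \<in> S. nverts t \<le> N} \<and> nverts t = n. x ^ nverts t)"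
      by (simp add: tree_count_def)
  qed
  also have "\<dots> = partial_gf S N x"
    unfolding partial_gf_def by (rule sum.group) (auto intro: finite_trees_le)
  finally show ?thesis ..
qed

lemma partial_gf_nonneg: "0 \<le> x \<Longrightarrow> 0 \<le> partial_gf S N x"
  by (auto simp: partial_gf_def intro: sum_nonneg)

lemma partial_gf_mono_set: "S \<subseteq> S' \<Longrightarrow> 0 \<le> x \<Longrightarrow> partial_gf S N x \<le> partial_gf S' N x"
  unfolding partial_gf_def by (rule sum_mono2) (auto intro: finite_trees_le)

lemma partial_gf_mono_order: "N \<le> N' \<Longrightarrow> 0 \<le> x \<Longrightarrow> partial_gf S N x \<le> partial_gf S N' x"
  unfolding partial_gf_def by (rule sum_mono2) (auto intro: finite_trees_le)

lemma partial_gf_mono_arg: "0 \<le> x \<Longrightarrow> x \<le> y \<Longrightarrow> partial_gf S N x \<le> partial_gf S N y"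
  unfolding partial_gf_def by (rule sum_mono) (auto intro: power_mono)

text \<open>Children of a tree with at most \<open>Suc N\<close> vertices have at most
  \<open>N\<close>, and expanding the product runs through all multisets of such children. Larger
  trees also appear in the expansion, hence only an inequality. The shift from \<open>N\<close> to
  \<open>Suc N\<close> is what the later inductions run on.\<close>

lemma partial_gf_upper:
  assumes closed: "\<And>M. Node M \<in> S' \<Longrightarrow> set_mset M \<subseteq> S" and x: "0 < x" "x < 1"
  shows "partial_gf S' (Suc N) x \<le> x * (\<Prod>c | c \<in> S \<and> nverts c \<le> N. 1 / (1 - x ^ nverts c))"
proof -
  have "partial_gf S' (Suc N) x \<le> (\<Sum>t\<in>bounded_trees {c \<in> S. nverts c \<le> N} N. x ^ nverts t)"
    unfolding partial_gf_def
  proof (rule sum_mono2)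
    show "{t. t \<in> S' \<and> nverts t \<le> Suc N} \<subseteq> bounded_trees {c \<in> S. nverts c \<le> N} N"
    proof
      fix t assume "t \<in> {t. t \<in> S' \<and> nverts t \<le> Suc N}"
      then show "t \<in> bounded_trees {c \<in> S. nverts c \<le> N} N"
        by (cases t) (auto intro!: children_bounded_trees dest: closed)
    qed
  qed (use x in \<open>auto intro: finite_bounded_trees finite_trees_le\<close>)
  also have "\<dots> = x * (\<Prod>c | c \<in> S \<and> nverts c \<le> N. \<Sum>i\<le>N. (x ^ nverts c) ^ i)"
    by (rule sum_bounded_trees) (rule finite_trees_le)
  also have "\<dots> \<le> x * (\<Prod>c | c \<in> S \<and> nverts c \<le> N. 1 / (1 - x ^ nverts c))"
  proof (intro mult_left_mono prod_mono)
    fix c :: rtree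
    have q: "0 \<le> x ^ nverts c" "x ^ nverts c < 1"
      using x nverts_pos[of c] by (auto simp: power_less_one_iff)
    have "(\<Sum>i\<le>N. (x ^ nverts c) ^ i) = (1 - (x ^ nverts c) ^ Suc N) / (1 - x ^ nverts c)"
      using q by (subst sum_gp0) auto
    also have "\<dots> \<le> 1 / (1 - x ^ nverts c)"
      using q by (intro divide_right_mono) auto
    finally show "0 \<le> (\<Sum>i\<le>N. (x ^ nverts c) ^ i) \<and> (\<Sum>i\<le>N. (x ^ nverts c) ^ i) \<le> 1 / (1 - x ^ nverts c)"
      using q by (auto intro: sum_nonneg)
  qed (use x in auto)
  finally show ?thesis .
qed

text \<open>Capping the multiplicities at \<open>m\<close> gives a sum over finitely many trees,
  bounded by hypothesis; letting \<open>m\<close> grow turns the truncated geometric series into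
  full ones. This is the converse direction of the functional equation.\<close>

lemma prod_lower:
  fixes x :: real
  assumes x: "0 < x" "x < 1" and F: "finite F"
    and bound: "\<And>m. (\<Sum>t\<in>bounded_trees F m. x ^ nverts t) \<le> B"
  shows "x * (\<Prod>c\<in>F. 1 / (1 - x ^ nverts c)) \<le> B"
proof (rule LIMSEQ_le_const2)
  show "(\<lambda>m. x * (\<Prod>c\<in>F. \<Sum>i\<le>m. (x ^ nverts c) ^ i))
      \<longlonglongrightarrow> x * (\<Prod>c\<in>F. 1 / (1 - x ^ nverts c))"
  proof (intro tendsto_mult tendsto_const tendsto_prod)
    fix c :: rtree
    have "norm (x ^ nverts c) < 1"
      using x nverts_pos[of c] by (auto simp: power_less_one_iff)
    from geometric_sums[OF this]
    show "(\<lambda>m. \<Sum>i\<le>m. (x ^ nverts c) ^ i) \<longlonglongrightarrow> 1 / (1 - x ^ nverts c)"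
      by (simp add: sums_def_le)
  qed
  show "\<exists>N. \<forall>m\<ge>N. x * (\<Prod>c\<in>F. \<Sum>i\<le>m. (x ^ nverts c) ^ i) \<le> B"
    using bound sum_bounded_trees[OF F] by auto
qed


section \<open>The critical radius\<close>

lemma tree_count_posI: "t \<in> S \<Longrightarrow> nverts t = n \<Longrightarrow> 0 < tree_count S n"
  unfolding tree_count_def using finite_trees_eq[of S n] by (auto simp: card_gt_0_iff)

lemma tree_count_pos: "0 < n \<Longrightarrow> 0 < tree_count UNIV n"
proof (induction n rule: nat_induct_non_zero)
  case 1
  show ?case by (rule tree_count_posI[of "Node {#}"]) auto
next
  case (Suc n)
  then obtain t where "nverts t = n"
    by (force simp: tree_count_def card_gt_0_iff)
  then show ?case by (intro tree_count_posI[of "Node {#t#}"]) auto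
qed

lemma tree_count_0: "tree_count S 0 = 0"
  by (simp add: tree_count_def)

\<comment> \<open>For \<open>n \<noteq> k\<close> the multiset \<open>{#a, b#}\<close> determines the ordered pair \<open>(a, b)\<close>.\<close>
lemma tree_count_mult_le:
  assumes "n \<noteq> k"
  shows "tree_count UNIV n * tree_count UNIV k \<le> tree_count UNIV (n + k + 1)"
proof -
  have "inj_on (\<lambda>(a, b). Node {#a, b#}) ({t \<in> UNIV. nverts t = n} \<times> {t \<in> UNIV. nverts t = k})"
    using assms by (auto simp: inj_on_def add_eq_conv_ex)
  moreover have "(\<lambda>(a, b). Node {#a, b#}) ` ({t \<in> UNIV. nverts t = n} \<times> {t \<in> UNIV. nverts t = k})
      \<subseteq> {t \<in> UNIV. nverts t = n + k + 1}"
    by auto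
  ultimately show ?thesis
    unfolding tree_count_def card_cartesian_product[symmetric]
    by (rule card_inj_on_le) (rule finite_trees_eq)
qed

text \<open>
  Attaching a tree \<open>a\<close> below the root of \<open>b\<close> is injective in \<open>(a, b)\<close> once \<open>a\<close> is remembered,
  and the distinct limbs at the children of the root have at most \<open>n - 1\<close> vertices together.
\<close>

lemma tree_count_convolution_le:
  "(\<Sum>k\<le>n. k * tree_count UNIV k * tree_count UNIV (n - k)) \<le> (n - 1) * tree_count UNIV n"
proof -
  define P where "P = {(a, b). nverts a + nverts b = n}"
  define Q where "Q = (SIGMA t : {t \<in> UNIV. nverts t = n}. set_mset (children t))"
  define f where "f = (\<lambda>(a, b). (Node (add_mset a (children b)), a))"
  have finP: "finite P"
    by (rule finite_subset[of _ "{t. nverts t \<le> n} \<times> {t. nverts t \<le> n}"])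
      (auto simp: P_def finite_nverts_le)
  have finQ: "finite Q"
    unfolding Q_def by (intro finite_SigmaI finite_trees_eq) auto
  have nverts_attach: "nverts (Node (add_mset a (children b))) = nverts a + nverts b" for a b
    by (cases b) simp
  have "(\<Sum>k\<le>n. k * tree_count UNIV k * tree_count UNIV (n - k))
      = (\<Sum>k\<le>n. \<Sum>p | p \<in> P \<and> nverts (fst p) = k. nverts (fst p))"
  proof (rule sum.cong[OF refl])
    fix k assume "k \<in> {..n}"
    then have "{p. p \<in> P \<and> nverts (fst p) = k}
        = {t \<in> UNIV. nverts t = k} \<times> {t \<in> UNIV. nverts t = n - k}"
      by (auto simp: P_def)
    then have "card {p. p \<in> P \<and> nverts (fst p) = k} = tree_count UNIV k * tree_count UNIV (n - k)"
      by (simp only: tree_count_def card_cartesian_product)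
    then show "k * tree_count UNIV k * tree_count UNIV (n - k)
        = (\<Sum>p | p \<in> P \<and> nverts (fst p) = k. nverts (fst p))"
      by simp
  qed
  also have "\<dots> = (\<Sum>p\<in>P. nverts (fst p))"
    by (rule sum.group) (auto simp: finP, auto simp: P_def)
  also have "\<dots> = (\<Sum>q\<in>f ` P. nverts (snd q))"
  proof -
    have "inj_on f P"
      by (auto simp: inj_on_def f_def intro: rtree.expand)
    then show ?thesis
      by (simp add: sum.reindex f_def case_prod_unfold)
  qed
  also have "\<dots> \<le> (\<Sum>q\<in>Q. nverts (snd q))"
  proof (rule sum_mono2[OF finQ])
    show "f ` P \<subseteq> Q"
      using nverts_attach by (auto simp: f_def P_def Q_def simp del: nverts.simps)
  qed simp
  also have "\<dots> = (\<Sum>t | t \<in> UNIV \<and> nverts t = n. \<Sum>c\<in>set_mset (children t). nverts c)"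
    unfolding Q_def using finite_trees_eq[of UNIV n]
    by (subst sum.Sigma) (auto intro!: sum.cong)
  also have "\<dots> \<le> (\<Sum>t | t \<in> UNIV \<and> nverts t = n. n - 1)"
  proof (rule sum_mono)
    fix t assume t: "t \<in> {t. t \<in> UNIV \<and> nverts t = n}"
    have "(\<Sum>c\<in>set_mset (children t). nverts c)
        \<le> (\<Sum>c\<in>set_mset (children t). count (children t) c * nverts c)"
      by (rule sum_mono) (simp add: Suc_le_eq)
    also have "\<dots> = n - 1"
      using nverts_Node_sum[of "set_mset (children t)" "children t"] t by simp
    finally show "(\<Sum>c\<in>set_mset (children t). nverts c) \<le> n - 1" .
  qed
  finally show ?thesis
    by (simp add: tree_count_def mult.commute)
qed

text \<open>Multiplying the convolution bound by \<open>z ^ n\<close> and summing gives D * T \<le>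
  D - T, where D is the sum of the series assumed summable and T that of the undifferentiated one.
  Hence T * (1 + D) \<le> D, so T \<le> 1. Finiteness of D legitimates the Cauchy product.\<close>

lemma partial_gf_le_one:
  assumes z: "0 < z" and sD: "summable (\<lambda>n. real n * tree_count UNIV n * z ^ n)"
  shows "partial_gf UNIV N z \<le> 1"
proof -
  define t where "t = (\<lambda>n. real (tree_count UNIV n) * z ^ n)"
  define d where "d = (\<lambda>n. real n * tree_count UNIV n * z ^ n)"
  have t0: "t n \<ge> 0" "d n \<ge> 0" for n using z by (auto simp: t_def d_def)
  have td: "t n \<le> d n" for n
    using z by (cases n) (auto simp: t_def d_def tree_count_0 algebra_simps)
  have sd: "summable d" using sD by (simp add: d_def)
  have st: "summable t"
    by (rule summable_comparison_test'[OF sd, of 0]) (use t0 td in auto)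
  have prod: "(\<lambda>n. \<Sum>k\<le>n. d k * t (n - k)) sums ((\<Sum>k. d k) * (\<Sum>k. t k))"
    by (rule Cauchy_product_sums) (use sd st t0 in auto)
  have diff: "(\<lambda>n. d n - t n) sums ((\<Sum>k. d k) - (\<Sum>k. t k))"
    using sd st by (intro sums_diff summable_sums)
  have le: "(\<Sum>k\<le>n. d k * t (n - k)) \<le> d n - t n" for n
  \<comment> \<open>The truncated \<open>n - 1\<close> of the convolution bound agrees with real
    subtraction only for positive \<open>n\<close>; at 0 both sides vanish.\<close>
  proof (cases n)
    case 0
    then show ?thesis by (simp add: d_def t_def tree_count_0)
  next
    case (Suc m)
    have "(\<Sum>k\<le>n. d k * t (n - k))
        = (\<Sum>k\<le>n. real (k * tree_count UNIV k * tree_count UNIV (n - k)) * z ^ n)"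
    proof (rule sum.cong[OF refl])
      fix k assume "k \<in> {..n}"
      then have "z ^ n = z ^ k * z ^ (n - k)" by (simp add: power_add[symmetric])
      then show "d k * t (n - k) = real (k * tree_count UNIV k * tree_count UNIV (n - k)) * z ^ n"
        by (simp add: d_def t_def)
    qed
    also have "\<dots> = real (\<Sum>k\<le>n. k * tree_count UNIV k * tree_count UNIV (n - k)) * z ^ n"
      by (simp add: sum_distrib_right)
    also have "\<dots> \<le> real ((n - 1) * tree_count UNIV n) * z ^ n"
      using z tree_count_convolution_le[of n] by (intro mult_right_mono) (auto simp only: of_nat_le_iff zero_le_power less_imp_le)
    also have "\<dots> = d n - t n"
      by (simp add: Suc d_def t_def algebra_simps)
    finally show ?thesis .
  qed
  have "(\<Sum>k. d k) * (\<Sum>k. t k) \<le> (\<Sum>k. d k) - (\<Sum>k. t k)"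
    by (rule sums_le[OF le prod diff])
  then have product: "(\<Sum>k. t k) * (1 + (\<Sum>k. d k)) \<le> (\<Sum>k. d k)"
    by (simp add: algebra_simps)
  have "0 \<le> (\<Sum>k. d k)" using t0 sd by (intro suminf_nonneg) auto
  moreover from product have "(\<Sum>k. t k) * (1 + (\<Sum>k. d k)) \<le> 1 * (1 + (\<Sum>k. d k))"
    by (rule order_trans) simp
  ultimately have "(\<Sum>k. t k) \<le> 1"
    by (intro mult_right_le_imp_le[of _ "1 + (\<Sum>k. d k)" 1]) linarith+
  moreover have "partial_gf UNIV N z \<le> (\<Sum>k. t k)"
    unfolding partial_gf_eq using sum_le_suminf[OF st, of "{..N}"] t0 by (simp add: t_def)
  ultimately show ?thesis by simp
qed

text \<open>The recursion from \<open>N\<close> to \<open>Suc N\<close> preserves the bound 1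
  because 1/9 * exp 2 \<le> 1, a consequence of e \<le> 3. The 2 in the exponent comes from 1 / (1 -
  q) \<le> 1 + 2 * q for small q. This provides a positive point for the definition of the critical
  radius.\<close>

lemma partial_gf_ninth_le_one: "partial_gf UNIV N (1 / 9) \<le> 1"
proof (induction N)
  case 0
  then show ?case by (simp add: partial_gf_def)
next
  case (Suc N)
  have "partial_gf UNIV (Suc N) (1 / 9)
      \<le> 1 / 9 * (\<Prod>c | c \<in> UNIV \<and> nverts c \<le> N. 1 / (1 - (1 / 9 :: real) ^ nverts c))"
    by (rule partial_gf_upper) auto
  also have "\<dots> \<le> 1 / 9 * (\<Prod>c | c \<in> UNIV \<and> nverts c \<le> N. exp (2 * (1 / 9) ^ nverts c))"
  proof (intro mult_left_mono prod_mono conjI)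
    fix c :: rtree
    obtain k where k: "nverts c = Suc k" using nverts_pos[of c] gr0_conv_Suc by auto
    define q where "q = (1 / 9 :: real) ^ nverts c"
    have q: "0 \<le> q" "q \<le> 1 / 9"
      unfolding q_def k using power_le_one[of "1/9::real" k] by auto
    have "1 / (1 - q) \<le> 1 + 2 * q"
      using q mult_nonneg_nonneg[of q "1 - 2 * q"] by (simp add: field_simps)
    also have "\<dots> \<le> exp (2 * q)" by (rule exp_ge_add_one_self)
    finally show "1 / (1 - (1 / 9 :: real) ^ nverts c) \<le> exp (2 * (1 / 9) ^ nverts c)"
      by (simp add: q_def)
    show "0 \<le> 1 / (1 - (1 / 9 :: real) ^ nverts c)"
      using q by (simp add: q_def)
  qed auto
  also have "\<dots> = 1 / 9 * exp (2 * partial_gf UNIV N (1 / 9))"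
    using finite_nverts_le[of N] by (simp add: exp_sum partial_gf_def sum_distrib_left)
  also have "\<dots> \<le> 1 / 9 * exp 2"
    using Suc by simp
  also have "exp (2::real) \<le> 9"
  proof -
    have "exp (2::real) = exp 1 ^ 2" by (simp flip: exp_of_nat_mult)
    also have "\<dots> \<le> 3 ^ 2" by (rule power_mono) (use exp_le in auto)
    finally show ?thesis by simp
  qed
  finally show ?case by simp
qed

text \<open>If the terms stayed bounded at some y > \<rho>, the differentiated series would converge
  at a point strictly between, and \<open>partial_gf_le_one\<close> would place that point in the
  set whose supremum is \<rho>.\<close>

lemma critical_radius:
  obtains \<rho> where "0 < \<rho>" "\<rho> < 1" "\<And>N. partial_gf UNIV N \<rho> \<le> 1"
    "\<And>(y :: real) (K :: real). \<rho> < y \<Longrightarrow> \<exists>n. K < tree_count UNIV n * y ^ n"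
proof -
  define X where "X = {x. 0 \<le> x \<and> (\<forall>N. partial_gf UNIV N x \<le> 1)}"
  define \<rho> where "\<rho> = Sup X"
  \<comment> \<open>Trees with one and two vertices alone contribute this much; the square is what
    makes \<rho> < 1 strict.\<close>
  have two: "x + x ^ 2 \<le> 1" if "x \<in> X" for x
  proof -
    have "x + x ^ 2 \<le> tree_count UNIV 1 * x + tree_count UNIV 2 * x ^ 2"
      using that tree_count_pos[of 1] tree_count_pos[of 2]
      by (intro add_mono) (auto simp: X_def intro!: mult_le_cancel_right1[THEN iffD2])
    also have "\<dots> = partial_gf UNIV 2 x"
      unfolding partial_gf_eq by (simp add: numeral_2_eq_2 tree_count_0)
    also have "\<dots> \<le> 1" using that by (simp add: X_def)
    finally show ?thesis .
  qed
  have bdd: "bdd_above X"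
  proof (rule bdd_aboveI[of _ 1])
    fix x assume "x \<in> X"
    from two[OF this] show "x \<le> 1" using zero_le_power2[of x] by linarith
  qed
  have mem: "1 / 9 \<in> X"
    using partial_gf_ninth_le_one by (simp add: X_def)
  have pos: "1 / 9 \<le> \<rho>"
    unfolding \<rho>_def using mem bdd by (rule cSup_upper)
  have below: "partial_gf UNIV N x \<le> 1" if x: "0 \<le> x" "x < \<rho>" for x N
  proof -
    obtain x' where "x' \<in> X" "x < x'"
      using x mem less_cSup_iff[OF _ bdd] unfolding \<rho>_def by blast
    then have "partial_gf UNIV N x' \<le> 1" by (simp add: X_def)
    then show ?thesis
      using partial_gf_mono_arg[of x x' UNIV N] x \<open>x < x'\<close> by linarith
  qed
  \<comment> \<open>Each partial sum is a polynomial, so the bound reaches \<rho> as a limit from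
    the left.\<close>
  have at: "partial_gf UNIV N \<rho> \<le> 1" for N
  proof (rule tendsto_upperbound)
    show "((\<lambda>x. partial_gf UNIV N x) \<longlongrightarrow> partial_gf UNIV N \<rho>) (at_left \<rho>)"
      unfolding partial_gf_eq by (intro tendsto_intros)
    show "\<forall>\<^sub>F x in at_left \<rho>. partial_gf UNIV N x \<le> 1"
      using pos below by (intro eventually_at_leftI[of 0]) auto
  qed simp
  then have "\<rho> \<in> X" using pos by (simp add: X_def)
  from two[OF this] have "\<rho> < 1" using pos zero_less_power[of \<rho> 2] by linarith
  moreover have "\<exists>n. K < tree_count UNIV n * y ^ n" if "\<rho> < y" for y K :: real
  proof (rule ccontr)
    assume "\<not> ?thesis"
    then have K: "tree_count UNIV n * y ^ n \<le> K" for n by (auto simp: not_less)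
    \<comment> \<open>The gap between \<open>z\<close> and \<open>y\<close> absorbs the factor
      \<open>n\<close> produced by differentiation.\<close>
    obtain z where z: "\<rho> < z" "z < y" using \<open>\<rho> < y\<close> dense by blast
    have pos': "0 < z" "0 < y" using pos z by auto
    have "summable (\<lambda>n. real n * (z / y) ^ n)"
    proof -
      have "summable (\<lambda>n. diffs (\<lambda>_. 1::real) n * (z / y) ^ n)"
      proof (rule termdiff_converges[where K = 1])
        show "norm (z / y) < 1" using z pos' by simp
      qed (auto intro!: summable_geometric)
      then have "summable (\<lambda>n. real (Suc n) * (z / y) ^ n)"
        by (simp add: diffs_def)
      then have "summable (\<lambda>n. real (Suc n) * (z / y) ^ n * (z / y))"
        by (rule summable_mult2)
      then have "summable (\<lambda>n. real (Suc n) * (z / y) ^ Suc n)"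
        by (simp add: mult_ac)
      then show ?thesis by (simp only: summable_Suc_iff[of "\<lambda>n. real n * (z / y) ^ n"])
    qed
    then have "summable (\<lambda>n. K * (real n * (z / y) ^ n))"
      by (rule summable_mult)
    then have "summable (\<lambda>n. real n * tree_count UNIV n * z ^ n)"
    proof (rule summable_comparison_test'[where N = 0])
      fix n :: nat
      have "real n * tree_count UNIV n * z ^ n = (tree_count UNIV n * y ^ n) * (real n * (z / y) ^ n)"
        using pos' by (simp add: power_divide)
      also have "\<dots> \<le> K * (real n * (z / y) ^ n)"
        using K pos' by (intro mult_right_mono) auto
      finally show "norm (real n * tree_count UNIV n * z ^ n) \<le> K * (real n * (z / y) ^ n)"
        using pos' by simp
    qed
    then have "z \<in> X" using partial_gf_le_one pos' by (simp add: X_def)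
    then have "z \<le> \<rho>" unfolding \<rho>_def using bdd by (rule cSup_upper)
    then show False using z by simp
  qed
  ultimately show ?thesis using that[of \<rho>] at pos by simp
qed

text \<open>Joining a tree with \<open>k\<close> vertices to one with \<open>n\<close> under a new
  root multiplies the weighted count by at least \<open>tree_count UNIV k * y ^ k * y\<close>, which
  exceeds 1. So the weighted counts do not decrease along steps of length \<open>k + 1\<close>, and
  one large term controls all later ones.\<close>

lemma tree_count_lower_bound:
  fixes y :: real
  assumes y: "0 < y" and k: "1 / y < tree_count UNIV k * y ^ k"
  obtains \<delta> where "0 < \<delta>" "\<And>n. k < n \<Longrightarrow> \<delta> \<le> tree_count UNIV n * y ^ n"
proof -
  define c where "c = (\<lambda>n. tree_count UNIV n * y ^ n)"
  \<comment> \<open>The window has \<open>k + 1\<close> consecutive indices, the length of one step,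
    so every larger index descends into it. Staying above \<open>k\<close> secures the inequality of
    sizes that \<open>tree_count_mult_le\<close> demands.\<close>
  define \<delta> where "\<delta> = Min (c ` {k<..2 * k + 1})"
  have step: "c n \<le> c (n + k + 1)" if "k < n" for n
  proof -
    have "c n = c n * (1 / y) * y" using y by simp
    also have "\<dots> \<le> c n * c k * y"
      using y k by (intro mult_right_mono mult_left_mono) (auto simp: c_def)
    also have "\<dots> = real (tree_count UNIV n * tree_count UNIV k) * y ^ (n + k + 1)"
      by (simp add: c_def power_add mult_ac)
    also have "\<dots> \<le> c (n + k + 1)"
      unfolding c_def using y tree_count_mult_le[of n k] that
      by (intro mult_right_mono) (auto simp only: of_nat_le_iff zero_le_power less_imp_le)
    finally show ?thesis .
  qed
  have "0 < \<delta>"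
    unfolding \<delta>_def using y tree_count_pos by (subst Min_gr_iff) (auto simp: c_def)
  moreover have "\<delta> \<le> c n" if "k < n" for n
    using that
  proof (induction n rule: less_induct)
    case (less n)
    show ?case
    proof (cases "n \<le> 2 * k + 1")
      case True
      then show ?thesis unfolding \<delta>_def using less.prems by (intro Min_le) auto
    next
      case False
      then have "\<delta> \<le> c (n - (k + 1))" by (intro less.IH) auto
      also have "\<dots> \<le> c n" using step[of "n - (k + 1)"] False by simp
      finally show ?thesis .
    qed
  qed
  ultimately show ?thesis using that by (simp add: c_def)
qed

section \<open>Trees avoiding a limb\<close>

definition avoiding :: "rtree \<Rightarrow> rtree set" where
  "avoiding L = {t. L \<notin> limbs t}"

lemma avoiding_Node: "Node M \<in> avoiding L \<longleftrightarrow> Node M \<noteq> L \<and> set_mset M \<subseteq> avoiding L"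
  by (auto simp: avoiding_def)

lemma L_notin_avoiding: "L \<notin> avoiding L"
  by (simp add: avoiding_def self_in_limbs)

text \<open>A child of \<open>L\<close> has fewer vertices than \<open>L\<close>, while a limb never
  has more vertices than its tree.\<close>

lemma children_avoiding:
  assumes "c \<in># children L"
  shows "c \<in> avoiding L"
proof -
  have "nverts c < nverts L"
    using nverts_child_less[of c "children L"] assms by simp
  then show ?thesis
    using nverts_limb_le[of L c] by (auto simp: avoiding_def)
qed

lemma Node_in_insert_avoiding: "Node M \<in> insert L (avoiding L) \<longleftrightarrow> set_mset M \<subseteq> avoiding L"
  using children_avoiding[of _ L] by (auto simp: avoiding_Node)

lemma partial_gf_insert:
  assumes "t \<notin> S" "nverts t \<le> N"
  shows "partial_gf (insert t S) N x = x ^ nverts t + partial_gf S N x"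
proof -
  have "{s. s \<in> insert t S \<and> nverts s \<le> N} = insert t {s. s \<in> S \<and> nverts s \<le> N}"
    using assms by auto
  then show ?thesis
    using assms finite_trees_le[of S N] by (simp add: partial_gf_def)
qed

text \<open>The side bound \<open>l \<le> N\<close> allows a caller to split off the term of a tree
  with \<open>l\<close> vertices by \<open>partial_gf_insert\<close>.\<close>

lemma sum_le_partial_gf:
  assumes "finite F" "F \<subseteq> S" "0 \<le> x"
  obtains N where "l \<le> N" "(\<Sum>t\<in>F. x ^ nverts t) \<le> partial_gf S N x"
proof -
  obtain N where N: "\<And>t. t \<in> F \<Longrightarrow> nverts t \<le> N"
    using finite_nat_set_iff_bounded_le[of "nverts ` F"] assms(1) by auto
  have "(\<Sum>t\<in>F. x ^ nverts t) \<le> partial_gf S (max l N) x"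
    unfolding partial_gf_def
    using assms N by (intro sum_mono2 finite_trees_le) (auto simp: le_max_iff_disj)
  then show ?thesis by (rule that[rotated]) simp
qed

section \<open>Estimates slightly beyond the critical radius\<close>

text \<open>This is the mean value estimate for the k-th power, multiplied by \<open>z\<close> so
  that no exponent \<open>k - 1\<close> occurs.\<close>

lemma power_diff_bound:
  fixes x y z :: real
  assumes "0 \<le> x" "x \<le> y" "y \<le> z"
  shows "z * (y ^ k - x ^ k) \<le> k * (y - x) * z ^ k"
proof (induction k)
  case (Suc k)
  have "z * (y ^ Suc k - x ^ Suc k) = y * (z * (y ^ k - x ^ k)) + z * (y - x) * x ^ k"
    by (simp add: algebra_simps)
  also have "\<dots> \<le> z * (k * (y - x) * z ^ k) + z * (y - x) * z ^ k"
  proof (rule add_mono)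
    have "0 \<le> z * (y ^ k - x ^ k)"
      using assms by (intro mult_nonneg_nonneg) (auto intro: power_mono)
    then show "y * (z * (y ^ k - x ^ k)) \<le> z * (k * (y - x) * z ^ k)"
      using assms Suc by (intro mult_mono[OF _ Suc]) auto
    show "z * (y - x) * x ^ k \<le> z * (y - x) * z ^ k"
      using assms by (intro mult_left_mono power_mono) auto
  qed
  also have "\<dots> = Suc k * (y - x) * z ^ Suc k"
    by (simp add: algebra_simps)
  finally show ?case .
qed simp

lemma n_times_power_bounded:
  fixes x :: real
  assumes "0 \<le> x" "x < 1"
  obtains C where "0 < C" "\<And>n. n * x ^ n \<le> C"
proof -
  have "(\<lambda>n. real n * x ^ n) \<longlonglongrightarrow> 0"
    using assms by (intro powser_times_n_limit_0) auto
  then have "Bseq (\<lambda>n. real n * x ^ n)"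
    by (intro convergent_imp_Bseq convergentI)
  then obtain C where "0 < C" "\<And>n. norm (real n * x ^ n) \<le> C"
    by (auto elim: BseqE)
  then show ?thesis
    using that[of C] by (force simp: abs_le_iff)
qed

text \<open>With p = \<open>\<rho> ^ k\<close> and q = \<open>y ^ k\<close>, the quotient of two
  factors is 1 + (q - p) + (q - p) * q / (1 - q). The terms q - p add up to the difference of
  partial sums. The last term is of second order, at most K * (y - \<rho>) * p, and the bound on the
  partial sums at \<rho> makes the total error independent of \<open>N\<close>.\<close>

lemma partial_product_ratio:
  assumes \<rho>: "0 < \<rho>" "\<rho> < 1" and bound: "\<And>N. partial_gf S N \<rho> \<le> 1"
  obtains y\<^sub>0 K where "\<rho> < y\<^sub>0" "y\<^sub>0 < 1"
    "\<And>y N. \<rho> < y \<Longrightarrow> y < y\<^sub>0 \<Longrightarrow>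
      (\<Prod>c | c \<in> S \<and> nverts c \<le> N. 1 / (1 - y ^ nverts c))
      \<le> (\<Prod>c | c \<in> S \<and> nverts c \<le> N. 1 / (1 - \<rho> ^ nverts c))
        * exp (partial_gf S N y - partial_gf S N \<rho> + K * (y - \<rho>))"
proof -
  \<comment> \<open>Below the square root of \<rho> one has \<open>z * z < \<rho>\<close>, so
    second-order terms are dominated by powers of \<rho> even after the factor \<open>k\<close> from
    the difference of powers.\<close>
  have "\<rho> < sqrt \<rho>"
    using \<rho> by (intro real_less_rsqrt) (simp add: power2_eq_square)
  then obtain z where z: "\<rho> < z" "z < sqrt \<rho>" using dense by blast
  have z0: "0 < z" using z \<rho> by linarith
  have z2: "z * z < \<rho>"
    using z \<rho> mult_strict_mono[of z "sqrt \<rho>" z "sqrt \<rho>"] z0 by simp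
  have z1: "z < 1" using z \<rho> by (auto intro: less_trans)
  obtain C where C: "0 < C" "\<And>n. n * (z * z / \<rho>) ^ n \<le> C"
    using n_times_power_bounded[of "z * z / \<rho>"] z2 \<rho> z0 by auto
  \<comment> \<open>The divisor \<open>z\<close> comes from \<open>power_diff_bound\<close>, and
    \<open>1 - z\<close> bounds 1 - q from below.\<close>
  define K where "K = C / (z * (1 - z))"
  have K0: "0 \<le> K" using C z0 z1 by (simp add: K_def)
  have "(\<Prod>c | c \<in> S \<and> nverts c \<le> N. 1 / (1 - y ^ nverts c))
      \<le> (\<Prod>c | c \<in> S \<and> nverts c \<le> N. 1 / (1 - \<rho> ^ nverts c))
        * exp (partial_gf S N y - partial_gf S N \<rho> + K * (y - \<rho>))"
    if y: "\<rho> < y" "y < z" for y N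
  proof -
    let ?F = "{c. c \<in> S \<and> nverts c \<le> N}"
    have factor: "1 / (1 - y ^ k) \<le> 1 / (1 - \<rho> ^ k) * exp (y ^ k - \<rho> ^ k + K * (y - \<rho>) * \<rho> ^ k)"
      if k: "0 < k" for k
    proof -
      define p q where "p = \<rho> ^ k" and "q = y ^ k"
      have pq: "0 < p" "p \<le> q" "q \<le> z"
      proof -
        show "0 < p" using \<rho> by (simp add: p_def)
        show "p \<le> q" using \<rho> y by (auto simp: p_def q_def intro: power_mono)
        have "q \<le> y ^ 1" unfolding q_def using k \<rho> y z1 by (intro power_decreasing) auto
        then show "q \<le> z" using y by simp
      qed
      have q1: "q < 1" using pq z1 by linarith
      have "(q - p) * q / (1 - q) \<le> K * (y - \<rho>) * p"
      proof -
        have "z * (q - p) * q \<le> (k * (y - \<rho>) * z ^ k) * z ^ k"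
          unfolding p_def q_def using y \<rho>
          by (intro mult_mono power_diff_bound power_mono) (auto intro!: mult_nonneg_nonneg)
        also have "\<dots> = (y - \<rho>) * (k * (z * z / \<rho>) ^ k) * p"
          using \<rho> by (simp add: p_def power_divide power_mult_distrib)
        also have "\<dots> \<le> (y - \<rho>) * C * p"
          using C y pq by (intro mult_right_mono mult_left_mono) auto
        finally have "(q - p) * q \<le> (y - \<rho>) * C * p / z"
          using z0 by (simp add: field_simps)
        then have "(q - p) * q / (1 - q) \<le> ((y - \<rho>) * C * p / z) / (1 - z)"
          using pq z0 z1 C y by (intro frac_le) (auto intro!: mult_nonneg_nonneg divide_nonneg_pos)
        then show ?thesis by (simp add: K_def mult_ac)
      qed
      then have "(q - p) / (1 - q) \<le> q - p + K * (y - \<rho>) * p"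
        using q1 by (simp add: field_simps)
      moreover have "(1 - p) / (1 - q) = 1 + (q - p) / (1 - q)"
        using q1 by (simp add: field_simps)
      ultimately have "(1 - p) / (1 - q) \<le> exp (q - p + K * (y - \<rho>) * p)"
        using exp_ge_add_one_self[of "q - p + K * (y - \<rho>) * p"] by linarith
      then have "(1 - p) / (1 - q) / (1 - p) \<le> exp (q - p + K * (y - \<rho>) * p) / (1 - p)"
        using pq q1 by (intro divide_right_mono) auto
      moreover have "(1 - p) / (1 - q) / (1 - p) = 1 / (1 - q)"
        using pq q1 by simp
      ultimately show ?thesis
        by (simp add: p_def q_def)
    qed
    have "(\<Prod>c\<in>?F. 1 / (1 - y ^ nverts c))
        \<le> (\<Prod>c\<in>?F. 1 / (1 - \<rho> ^ nverts c)
            * exp (y ^ nverts c - \<rho> ^ nverts c + K * (y - \<rho>) * \<rho> ^ nverts c))"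
      using factor y \<rho> z1 by (intro prod_mono) (auto intro!: power_le_one)
    also have "\<dots> = (\<Prod>c\<in>?F. 1 / (1 - \<rho> ^ nverts c))
        * exp (\<Sum>c\<in>?F. y ^ nverts c - \<rho> ^ nverts c + K * (y - \<rho>) * \<rho> ^ nverts c)"
      by (simp only: prod.distrib exp_sum[OF finite_trees_le])
    also have "(\<Sum>c\<in>?F. y ^ nverts c - \<rho> ^ nverts c + K * (y - \<rho>) * \<rho> ^ nverts c)
        = partial_gf S N y - partial_gf S N \<rho> + K * (y - \<rho>) * partial_gf S N \<rho>"
      by (simp add: partial_gf_def sum.distrib sum_subtractf sum_distrib_left)
    also have "(\<Prod>c\<in>?F. 1 / (1 - \<rho> ^ nverts c))
          * exp (partial_gf S N y - partial_gf S N \<rho> + K * (y - \<rho>) * partial_gf S N \<rho>)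
        \<le> (\<Prod>c\<in>?F. 1 / (1 - \<rho> ^ nverts c))
          * exp (partial_gf S N y - partial_gf S N \<rho> + K * (y - \<rho>))"
    proof (intro mult_left_mono)
      have "K * (y - \<rho>) * partial_gf S N \<rho> \<le> K * (y - \<rho>) * 1"
        using K0 y bound by (intro mult_left_mono) auto
      then show "exp (partial_gf S N y - partial_gf S N \<rho> + K * (y - \<rho>) * partial_gf S N \<rho>)
          \<le> exp (partial_gf S N y - partial_gf S N \<rho> + K * (y - \<rho>))" by simp
      show "0 \<le> (\<Prod>c\<in>?F. 1 / (1 - \<rho> ^ nverts c))"
        using \<rho> by (intro prod_nonneg) (auto intro: power_le_one)
    qed
    finally show ?thesis .
  qed
  with z z1 that[of z K] show ?thesis by blast
qed

text \<open>
  The partial sums \<open>u N y\<close> of the generating function at \<open>y\<close> satisfy a recursion whose right-hand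
  side, at the critical radius \<open>\<rho>\<close>, is a function of \<open>u N y\<close> with derivative \<open>B < 1\<close> at the fixed
  point. A small interval above the fixed point is therefore still mapped into itself for \<open>y\<close>
  slightly larger than \<open>\<rho>\<close>, which traps the partial sums.
\<close>

lemma avoiding_bounded_beyond_radius:
  assumes \<rho>: "0 < \<rho>" "\<rho> < 1" and bound: "\<And>N. partial_gf UNIV N \<rho> \<le> 1"
  obtains y C where "\<rho> < y" "\<And>N. partial_gf (avoiding L) N y \<le> C"
proof -
  define l where "l = nverts L"
  define u where "u = partial_gf (avoiding L)"
  have u_le: "u N \<rho> \<le> 1" for N
    using partial_gf_mono_set[of "avoiding L" UNIV \<rho> N] bound[of N] \<rho> by (simp add: u_def)
  have "incseq (\<lambda>N. u N \<rho>)"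
    unfolding u_def using \<rho> by (intro monoI partial_gf_mono_order) auto
  then obtain \<alpha> where \<alpha>: "(\<lambda>N. u N \<rho>) \<longlonglongrightarrow> \<alpha>" "\<And>N. u N \<rho> \<le> \<alpha>"
    using incseq_convergent[of "\<lambda>N. u N \<rho>" 1] u_le by blast
  define B where "B = \<alpha> + \<rho> ^ l"
  have insert: "partial_gf (insert L (avoiding L)) N x = x ^ l + u N x" if "l \<le> N" for N x
    using partial_gf_insert[OF L_notin_avoiding] that by (simp add: l_def u_def)
  \<comment> \<open>The tree \<open>Node {#L#}\<close> has \<open>Suc l\<close> vertices and is
    counted in neither summand of \<open>B\<close>, so it takes its share of the total bound
    1.\<close>
  have "B \<le> 1 - \<rho> ^ Suc l"
  proof -
    have "u N \<rho> \<le> 1 - \<rho> ^ Suc l - \<rho> ^ l" if "Suc l \<le> N" for N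
    proof -
      have "Node {#L#} \<notin> insert L (avoiding L)"
        unfolding Node_in_insert_avoiding by (simp add: L_notin_avoiding)
      then have "partial_gf (insert (Node {#L#}) (insert L (avoiding L))) N \<rho>
          = \<rho> ^ Suc l + (\<rho> ^ l + u N \<rho>)"
        using that insert[of N \<rho>] by (subst partial_gf_insert) (auto simp: l_def)
      moreover have "partial_gf (insert (Node {#L#}) (insert L (avoiding L))) N \<rho> \<le> 1"
        using partial_gf_mono_set[of _ UNIV \<rho> N] bound[of N] \<rho> by (force intro: order_trans)
      ultimately show ?thesis by linarith
    qed
    then have "\<alpha> \<le> 1 - \<rho> ^ Suc l - \<rho> ^ l"
      by (intro LIMSEQ_le_const2[OF \<alpha>(1)]) blast
    then show ?thesis by (simp add: B_def)
  qed
  moreover have "0 < \<rho> ^ Suc l" using \<rho> by simp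
  ultimately have B1: "B < 1" by linarith
  have "0 \<le> u 0 \<rho>" unfolding u_def using \<rho> by (intro partial_gf_nonneg) auto
  then have B0: "0 < B" using \<alpha>(2)[of 0] \<rho> unfolding B_def by (intro add_nonneg_pos) auto
  \<comment> \<open>Every tree built from avoiding children is \<open>L\<close> or avoiding, so any
    finite sum over such trees is at most the limit \<alpha> plus the term of
    \<open>L\<close>.\<close>
  have lower: "\<rho> * (\<Prod>c | c \<in> avoiding L \<and> nverts c \<le> N. 1 / (1 - \<rho> ^ nverts c)) \<le> B" for N
  proof (rule prod_lower)
    fix m
    let ?T = "bounded_trees {c. c \<in> avoiding L \<and> nverts c \<le> N} m"
    have "?T \<subseteq> insert L (avoiding L)"
    proof
      fix t assume "t \<in> ?T"
      then obtain M where "t = Node M" "set_mset M \<subseteq> avoiding L"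
        by (auto simp: bounded_trees_def)
      then show "t \<in> insert L (avoiding L)" by (simp only: Node_in_insert_avoiding)
    qed
    moreover have "finite ?T" by (intro finite_bounded_trees finite_trees_le)
    ultimately obtain N' where "l \<le> N'"
        "(\<Sum>t\<in>?T. \<rho> ^ nverts t) \<le> partial_gf (insert L (avoiding L)) N' \<rho>"
      using sum_le_partial_gf[of ?T "insert L (avoiding L)" \<rho> l] \<rho> by auto
    then show "(\<Sum>t\<in>?T. \<rho> ^ nverts t) \<le> B"
      using insert[of N' \<rho>] \<alpha>(2)[of N'] by (simp add: B_def)
  qed (use \<rho> finite_trees_le in auto)
  obtain y\<^sub>0 K where y0: "\<rho> < y\<^sub>0" "y\<^sub>0 < 1" and ratio: "\<And>y N. \<rho> < y \<Longrightarrow> y < y\<^sub>0 \<Longrightarrow>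
      (\<Prod>c | c \<in> avoiding L \<and> nverts c \<le> N. 1 / (1 - y ^ nverts c))
      \<le> (\<Prod>c | c \<in> avoiding L \<and> nverts c \<le> N. 1 / (1 - \<rho> ^ nverts c))
        * exp (u N y - u N \<rho> + K * (y - \<rho>))"
    using partial_product_ratio[of \<rho> "avoiding L"] \<rho> u_le unfolding u_def by blast
  have upper: "u (Suc N) y \<le> y / \<rho> * B * exp (u N y - u N \<rho> + K * (y - \<rho>)) - \<rho> ^ l"
    if y: "\<rho> < y" "y < y\<^sub>0" and N: "l \<le> Suc N" for y N
  proof -
    let ?P = "\<lambda>x. \<Prod>c | c \<in> avoiding L \<and> nverts c \<le> N. 1 / (1 - x ^ nverts c)"
    let ?e = "exp (u N y - u N \<rho> + K * (y - \<rho>))"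
    have "y ^ l + u (Suc N) y = partial_gf (insert L (avoiding L)) (Suc N) y"
      using insert N by simp
    also have "\<dots> \<le> y * ?P y"
      using \<rho> y y0 by (intro partial_gf_upper[OF Node_in_insert_avoiding[THEN iffD1]]) auto
    also have "\<dots> \<le> y * (?P \<rho> * ?e)"
      using ratio[OF y, of N] y \<rho> by (intro mult_left_mono) auto
    also have "\<dots> = y / \<rho> * (\<rho> * ?P \<rho>) * ?e"
      using \<rho> by simp
    also have "\<dots> \<le> y / \<rho> * B * ?e"
      using lower[of N] y \<rho> by (intro mult_right_mono mult_left_mono) auto
    finally have "y ^ l + u (Suc N) y \<le> y / \<rho> * B * ?e" .
    moreover have "\<rho> ^ l \<le> y ^ l" using \<rho> y by (intro power_mono) auto
    ultimately show ?thesis by linarith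
  qed
  \<comment> \<open>Half of the available gap: then B < 1 - \<delta>, and 1 - \<delta> \<le> exp (-
    \<delta>) turns this into a strict contraction of the interval of length \<delta>.\<close>
  define \<delta> where "\<delta> = (1 - B) / 2"
  have \<delta>: "0 < \<delta>" "\<delta> < 1" "B + \<delta> < 1" using B0 B1 by (auto simp: \<delta>_def field_simps)
  have "B * (exp \<delta> - 1) < \<delta>"
  proof -
    have "(1 - \<delta>) * exp \<delta> \<le> exp (- \<delta>) * exp \<delta>"
      using exp_ge_add_one_self[of "- \<delta>"] by (intro mult_right_mono) auto
    then have "(1 - \<delta>) * (exp \<delta> - 1) \<le> \<delta>"
      by (simp add: exp_minus field_simps)
    moreover have "B * (exp \<delta> - 1) < (1 - \<delta>) * (exp \<delta> - 1)"
      using \<delta> by (intro mult_strict_right_mono) auto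
    ultimately show ?thesis by linarith
  qed
  \<comment> \<open>This slack pays for replacing the partial sum at \<rho> by its limit \<alpha>
    from some index on.\<close>
  then obtain \<epsilon> where \<epsilon>: "0 < \<epsilon>" "B * (exp \<delta> - 1) + \<epsilon> < \<delta>"
    using dense[of 0 "\<delta> - B * (exp \<delta> - 1)"] by force
  have "\<forall>\<^sub>F N in sequentially. \<alpha> - \<epsilon> < u N \<rho>"
    using \<alpha>(1) \<epsilon>(1) by (intro order_tendstoD(1)) auto
  then obtain N\<^sub>0 where N0: "\<And>N. N\<^sub>0 \<le> N \<Longrightarrow> \<alpha> - \<epsilon> < u N \<rho>" "l \<le> N\<^sub>0"
    unfolding eventually_sequentially by (meson le_trans linorder_linear)
  \<comment> \<open>At y = \<rho> the expression is B * (exp \<delta> - 1) + \<epsilon> < \<delta>,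
    so by continuity the induction step still closes for y slightly larger.\<close>
  have "((\<lambda>y. B * (y / \<rho> * exp (\<delta> + K * (y - \<rho>)) - 1) + \<epsilon>)
      \<longlongrightarrow> B * (\<rho> / \<rho> * exp (\<delta> + K * (\<rho> - \<rho>)) - 1) + \<epsilon>) (at_right \<rho>)"
    using \<rho> by (intro tendsto_intros) auto
  then have "\<forall>\<^sub>F y in at_right \<rho>. B * (y / \<rho> * exp (\<delta> + K * (y - \<rho>)) - 1) + \<epsilon> < \<delta>"
    using \<epsilon> \<rho> by (intro order_tendstoD(2)) auto
  \<comment> \<open>The index \<open>N\<^sub>0\<close> is fixed before \<open>y\<close>, so
    continuity of a single polynomial starts the induction.\<close>
  moreover have "((\<lambda>y. u N\<^sub>0 y - u N\<^sub>0 \<rho>) \<longlongrightarrow> u N\<^sub>0 \<rho> - u N\<^sub>0 \<rho>) (at_right \<rho>)"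
    unfolding u_def partial_gf_eq by (intro tendsto_intros)
  then have "\<forall>\<^sub>F y in at_right \<rho>. u N\<^sub>0 y - u N\<^sub>0 \<rho> < \<delta>"
    using \<delta> by (intro order_tendstoD(2)) auto
  moreover have "\<forall>\<^sub>F y in at_right \<rho>. \<rho> < y \<and> y < y\<^sub>0"
    by (rule eventually_at_rightI[of \<rho> y\<^sub>0]) (use y0 in auto)
  ultimately have "\<forall>\<^sub>F y in at_right \<rho>. (B * (y / \<rho> * exp (\<delta> + K * (y - \<rho>)) - 1) + \<epsilon> < \<delta>
      \<and> u N\<^sub>0 y - u N\<^sub>0 \<rho> < \<delta>) \<and> (\<rho> < y \<and> y < y\<^sub>0)"
    by (rule eventually_conj[OF eventually_conj])
  from eventually_happens'[OF _ this] obtain y where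
    y: "B * (y / \<rho> * exp (\<delta> + K * (y - \<rho>)) - 1) + \<epsilon> < \<delta>" "u N\<^sub>0 y - u N\<^sub>0 \<rho> < \<delta>" "\<rho> < y" "y < y\<^sub>0"
    by auto
  have trapped: "u N y - u N \<rho> \<le> \<delta>" if "N\<^sub>0 \<le> N" for N
    using that
  proof (induction N rule: dec_induct)
    case base
    then show ?case using y by simp
  next
    case (step N)
    have "u (Suc N) y - u (Suc N) \<rho> \<le> (y / \<rho> * B * exp (u N y - u N \<rho> + K * (y - \<rho>)) - \<rho> ^ l) - (\<alpha> - \<epsilon>)"
      using upper[of y N] N0(1)[of "Suc N"] N0(2) step.hyps y by force
    also have "\<dots> \<le> (y / \<rho> * B * exp (\<delta> + K * (y - \<rho>)) - \<rho> ^ l) - (\<alpha> - \<epsilon>)"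
      using step.IH y \<rho> B0 by (intro diff_right_mono mult_left_mono) auto
    \<comment> \<open>Since B = \<alpha> + \<open>\<rho> ^ l\<close>, the two subtracted constants
      combine into the -1 inside the bracket.\<close>
    also have "\<dots> = B * (y / \<rho> * exp (\<delta> + K * (y - \<rho>)) - 1) + \<epsilon>"
      using \<rho> by (simp add: B_def field_simps)
    also have "\<dots> \<le> \<delta>" using y by simp
    finally show ?case .
  qed
  have "u N y \<le> \<alpha> + \<delta>" for N
  proof -
    have "u N y \<le> u (max N N\<^sub>0) y"
      unfolding u_def using \<rho> y by (intro partial_gf_mono_order) auto
    also have "\<dots> \<le> \<alpha> + \<delta>"
      using trapped[of "max N N\<^sub>0"] \<alpha>(2)[of "max N N\<^sub>0"] by simp
    finally show ?thesis .
  qed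
  then show ?thesis using that y(3) unfolding u_def by blast
qed

text \<open>For \<rho> < z < y, avoiding trees number at most a constant times
  \<open>(1 / y) ^ n\<close>, while all trees eventually number at least a constant times
  \<open>(1 / z) ^ n\<close>; the quotient decays like \<open>(z / y) ^ n\<close>.\<close>

lemma avoiding_proportion_tendsto_0:
  "(\<lambda>n. tree_count (avoiding L) n / tree_count UNIV n) \<longlonglongrightarrow> 0"
proof -
  obtain \<rho> where \<rho>: "0 < \<rho>" "\<rho> < 1" "\<And>N. partial_gf UNIV N \<rho> \<le> 1"
    and unbounded: "\<And>(y :: real) (K :: real). \<rho> < y \<Longrightarrow> \<exists>n. K < tree_count UNIV n * y ^ n"
    by (rule critical_radius) blast
  obtain y C where y: "\<rho> < y" and C: "\<And>N. partial_gf (avoiding L) N y \<le> C"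
    using avoiding_bounded_beyond_radius[OF \<rho>] by blast
  obtain z where z: "\<rho> < z" "z < y" using dense y by blast
  have pos: "0 < z" "0 < y" using \<rho> y z by auto
  obtain k where "1 / z < tree_count UNIV k * z ^ k" using unbounded z by blast
  then obtain \<delta> where \<delta>: "0 < \<delta>" "\<And>n. k < n \<Longrightarrow> \<delta> \<le> tree_count UNIV n * z ^ n"
    using tree_count_lower_bound[of z k] pos by blast
  have a: "tree_count (avoiding L) n * y ^ n \<le> C" for n
  proof -
    have "tree_count (avoiding L) n * y ^ n \<le> (\<Sum>i\<le>n. tree_count (avoiding L) i * y ^ i)"
      using pos by (intro member_le_sum) auto
    then show ?thesis using C[of n] by (simp add: partial_gf_eq)
  qed
  have "tree_count (avoiding L) n / tree_count UNIV n \<le> C / \<delta> * (z / y) ^ n" if "k < n" for n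
  proof -
    have "tree_count (avoiding L) n / tree_count UNIV n
        = (tree_count (avoiding L) n * y ^ n) * (z / y) ^ n / (tree_count UNIV n * z ^ n)"
      using pos by (simp add: power_divide)
    also have "\<dots> \<le> C * (z / y) ^ n / \<delta>"
      using pos a[of n] \<delta> that C[of 0]
      by (intro frac_le mult_right_mono) (auto intro!: mult_nonneg_nonneg order_trans[OF partial_gf_nonneg C])
    finally show ?thesis by simp
  qed
  then have upper: "\<forall>\<^sub>F n in sequentially.
      tree_count (avoiding L) n / tree_count UNIV n \<le> C / \<delta> * (z / y) ^ n"
    using eventually_gt_at_top[of k] by (rule eventually_mono[rotated]) blast
  have "(\<lambda>n. C / \<delta> * (z / y) ^ n) \<longlonglongrightarrow> C / \<delta> * 0"
    using pos z by (intro tendsto_mult tendsto_const LIMSEQ_realpow_zero) auto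
  then have limit: "(\<lambda>n. C / \<delta> * (z / y) ^ n) \<longlonglongrightarrow> 0" by simp
  have "\<forall>\<^sub>F n in sequentially. 0 \<le> real (tree_count (avoiding L) n) / tree_count UNIV n"
    by (intro always_eventually allI) simp
  from tendsto_sandwich[OF this upper tendsto_const limit] show ?thesis .
qed

lemma limb_proportion_tendsto_1:
  "(\<lambda>n. real (card {t. nverts t = n \<and> L \<in> limbs t}) / real (card {t. nverts t = n})) \<longlonglongrightarrow> 1"
proof (rule Lim_transform_eventually)
  have split: "real (card {t. nverts t = n \<and> L \<in> limbs t})
      = real (tree_count UNIV n) - real (tree_count (avoiding L) n)" for n
  proof -
    have "{t. nverts t = n \<and> L \<in> limbs t} = {t \<in> UNIV. nverts t = n} - {t \<in> avoiding L. nverts t = n}"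
      by (auto simp: avoiding_def)
    moreover have "{t \<in> avoiding L. nverts t = n} \<subseteq> {t \<in> UNIV. nverts t = n}" by auto
    ultimately show ?thesis
      using finite_trees_eq[of _ n] by (simp only: tree_count_def card_Diff_subset card_mono of_nat_diff)
  qed
  have total: "card {t. nverts t = n} = tree_count UNIV n" for n
    by (simp add: tree_count_def)
  \<comment> \<open>At n = 0 both quotients are 0 / 0 = 0 and the identity fails, so it can hold
    only eventually.\<close>
  have "1 - tree_count (avoiding L) n / tree_count UNIV n
      = real (card {t. nverts t = n \<and> L \<in> limbs t}) / real (card {t. nverts t = n})" if "0 < n" for n
    using tree_count_pos[OF that] by (simp add: split total diff_divide_distrib)
  then show "\<forall>\<^sub>F n in sequentially. 1 - tree_count (avoiding L) n / tree_count UNIV n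
      = real (card {t. nverts t = n \<and> L \<in> limbs t}) / real (card {t. nverts t = n})"
    by (intro eventually_mono[OF eventually_gt_at_top[of 0]]) simp
  have "(\<lambda>n. 1 - tree_count (avoiding L) n / tree_count UNIV n) \<longlonglongrightarrow> 1 - 0"
    by (intro tendsto_diff tendsto_const avoiding_proportion_tendsto_0)
  then show "(\<lambda>n. 1 - tree_count (avoiding L) n / tree_count UNIV n) \<longlonglongrightarrow> 1" by simp
qed

section \<open>Trees represented by a parent-child relation\<close>

text \<open>Distinct children with equal trees merge into one element with multiplicity. The
  finiteness premise matters because \<open>mset_set\<close> of an infinite set is empty, which
  would disguise an infinitely branching vertex as a leaf.\<close>

inductive represents :: "'a rel \<Rightarrow> 'a \<Rightarrow> rtree \<Rightarrow> bool" for R where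
  represents_Node: "finite (R `` {v}) \<Longrightarrow> \<forall>w\<in>R `` {v}. represents R w (f w) \<Longrightarrow>
    represents R v (Node (image_mset f (mset_set (R `` {v}))))"

lemma represents_unique: "represents R v s \<Longrightarrow> represents R v t \<Longrightarrow> s = t"
proof (induction arbitrary: t rule: represents.induct)
  case (represents_Node v f)
  from represents_Node.prems obtain g where
    t: "t = Node (image_mset g (mset_set (R `` {v})))" and "\<forall>w\<in>R `` {v}. represents R w (g w)"
    by cases blast
  then have "image_mset f (mset_set (R `` {v})) = image_mset g (mset_set (R `` {v}))"
    using represents_Node by (intro image_mset_cong) auto
  then show ?case by (simp add: t)
qed

lemma represents_exists:
  assumes "finite R" "acyclic R"
  shows "\<exists>t. represents R v t"
proof (induction v rule: wf_induct_rule[OF finite_acyclic_wf_converse[OF assms]])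
  case (1 v)
  then obtain f where "\<forall>w\<in>R `` {v}. represents R w (f w)"
    by (metis ImageE converse_iff singletonD)
  moreover have "finite (R `` {v})"
    using assms(1) by (rule finite_Image)
  ultimately show ?case by (blast intro: represents_Node)
qed

lemma rtrancl_Image_insert: "R\<^sup>* `` {v} = insert v (\<Union>w\<in>R `` {v}. R\<^sup>* `` {w})"
  by (auto elim: converse_rtranclE intro: converse_rtrancl_into_rtrancl)

text \<open>Both sides obey the same recursion: the vertex itself together with what lies below its
  children.\<close>

lemma limbs_represents: "represents R v t \<Longrightarrow> limbs t = {s. \<exists>w\<in>R\<^sup>* `` {v}. represents R w s}"
proof (induction rule: represents.induct)
  case (represents_Node v f)
  let ?t = "Node (image_mset f (mset_set (R `` {v})))"
  have t: "represents R v ?t"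
    using represents_Node by (intro represents.represents_Node) auto
  have "limbs ?t = insert ?t (\<Union>w\<in>R `` {v}. {s. \<exists>x\<in>R\<^sup>* `` {w}. represents R x s})"
    using represents_Node by simp
  also have "insert ?t X = {s. represents R v s} \<union> X" for X
    using t represents_unique[OF t] by blast
  also have "{s. represents R v s} \<union> (\<Union>w\<in>R `` {v}. {s. \<exists>x\<in>R\<^sup>* `` {w}. represents R x s})
      = {s. \<exists>w\<in>insert v (\<Union>w\<in>R `` {v}. R\<^sup>* `` {w}). represents R w s}"
    by blast
  finally show ?case
    unfolding rtrancl_Image_insert[of R v, symmetric] .
qed

lemma represents_restrict:
  assumes "represents R v t" "R\<^sup>* `` {v} \<subseteq> S"
  shows "represents (R \<inter> S \<times> S) v t"
  using assms
proof (induction rule: represents.induct)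
  case (represents_Node v f)
  have "(R \<inter> S \<times> S) `` {v} = R `` {v}"
    using represents_Node.prems by auto
  moreover have "represents (R \<inter> S \<times> S) w (f w)" if "w \<in> R `` {v}" for w
    using represents_Node that by (auto intro: converse_rtrancl_into_rtrancl)
  ultimately show ?case
    using represents_Node.hyps represents.represents_Node[of "R \<inter> S \<times> S" v f] by simp
qed

text \<open>The tree depends only on the child sets at and below \<open>v\<close>, and these are
  carried over exactly. This serves both graph isomorphisms and the relabelling of disjoint
  copies.\<close>

lemma represents_map:
  assumes "represents R v t" "R\<^sup>* `` {v} \<subseteq> V" "inj_on f V"
    and "\<And>a. a \<in> V \<Longrightarrow> R' `` {f a} = f ` (R `` {a})"
  shows "represents R' (f v) t"
  using assms(1,2)
proof (induction rule: represents.induct)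
  case (represents_Node v g)
  have "R `` {v} \<subseteq> V" and v: "v \<in> V" using represents_Node.prems by auto
  then have inj: "inj_on f (R `` {v})" using assms(3) inj_on_subset by blast
  define h where "h = g \<circ> the_inv_into (R `` {v}) f"
  have h: "h (f w) = g w" if "w \<in> R `` {v}" for w
    using the_inv_into_f_f[OF inj that] by (simp add: h_def)
  have children: "R' `` {f v} = f ` (R `` {v})" by (rule assms(4)[OF v])
  have "represents R' (f w) (g w)" if "w \<in> R `` {v}" for w
    using represents_Node that by (auto intro: converse_rtrancl_into_rtrancl)
  then have "represents R' (f v) (Node (image_mset h (mset_set (R' `` {f v}))))"
    using represents_Node.hyps h by (intro represents.represents_Node) (auto simp: children)
  also have "image_mset h (mset_set (R' `` {f v})) = image_mset g (mset_set (R `` {v}))"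
    unfolding children image_mset_mset_set[OF inj, symmetric] multiset.map_comp
    using represents_Node.hyps h by (intro image_mset_cong) simp
  finally show ?case .
qed

text \<open>With unique parents, two ancestors of \<open>x\<close> are comparable. A path from one
  sibling to a different one would enter it through the common parent \<open>v\<close> and close a
  cycle.\<close>

lemma rtrancl_Image_children_disjoint:
  assumes R: "single_valued (R\<inverse>)" "acyclic R"
    and "(v, w) \<in> R" "(v, w') \<in> R" "(w, x) \<in> R\<^sup>*" "(w', x) \<in> R\<^sup>*"
  shows "w = w'"
proof -
  have no: "w = w'" if vw: "(v, w) \<in> R" "(v, w') \<in> R" and "(w, w') \<in> R\<^sup>*" for w w'
    using that(3)
  proof (cases rule: rtranclE)
    case (step u)
    then have "u = v" using R(1) vw by (auto simp: single_valued_def)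
    then have "(v, v) \<in> R\<^sup>+" using step vw by (meson rtrancl_into_trancl2)
    then show ?thesis using R(2) by (simp add: acyclic_def)
  qed
  have "(x, w) \<in> (R\<inverse>)\<^sup>*" "(x, w') \<in> (R\<inverse>)\<^sup>*"
    using assms by (auto intro: rtrancl_converseI)
  from single_valued_confluent[OF R(1) this] have "(w, w') \<in> R\<^sup>* \<or> (w', w) \<in> R\<^sup>*"
    by (auto dest: rtrancl_converseD)
  then show ?thesis using no assms by metis
qed

lemma acyclic_no_parent_below:
  assumes "acyclic R" "(v, w) \<in> R" shows "(w, v) \<notin> R\<^sup>*"
  using assms by (meson acyclic_def rtrancl_into_trancl2)

text \<open>In a merely acyclic relation a shared descendant would be unfolded several times. Unique
  parents make the descendant sets of siblings disjoint, so that their cardinalities add.\<close>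

lemma nverts_represents:
  assumes R: "single_valued (R\<inverse>)" "acyclic R" and "represents R v t"
  shows "finite (R\<^sup>* `` {v}) \<and> card (R\<^sup>* `` {v}) = nverts t"
  using assms(3)
proof (induction rule: represents.induct)
  case (represents_Node v f)
  have fin: "finite (\<Union>w\<in>R `` {v}. R\<^sup>* `` {w})"
    using represents_Node by auto
  have "v \<notin> (\<Union>w\<in>R `` {v}. R\<^sup>* `` {w})"
    using acyclic_no_parent_below[OF R(2)] by auto
  then have "card (R\<^sup>* `` {v}) = Suc (card (\<Union>w\<in>R `` {v}. R\<^sup>* `` {w}))"
    unfolding rtrancl_Image_insert[of R v] using fin by simp
  also have "card (\<Union>w\<in>R `` {v}. R\<^sup>* `` {w}) = (\<Sum>w\<in>R `` {v}. card (R\<^sup>* `` {w}))"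
    using represents_Node rtrancl_Image_children_disjoint[OF R]
    by (intro card_UN_disjoint) blast+
  also have "\<dots> = (\<Sum>w\<in>R `` {v}. nverts (f w))"
    using represents_Node by (intro sum.cong) auto
  finally show ?case
    unfolding rtrancl_Image_insert[of R v] using fin
    by (simp add: sum_unfold_sum_mset multiset.map_comp comp_def)
qed

text \<open>Pairing one element with an equally labelled one and removing both reduces the problem.
  It matches the children of two vertices that represent the same tree.\<close>

lemma image_mset_eq_bij_betw:
  assumes "finite A" "finite B" "image_mset f (mset_set A) = image_mset g (mset_set B)"
  obtains h where "bij_betw h A B" "\<And>a. a \<in> A \<Longrightarrow> g (h a) = f a"
proof -
  have "\<exists>h. bij_betw h A B \<and> (\<forall>a\<in>A. g (h a) = f a)"
    using assms
  proof (induction A arbitrary: B rule: finite_induct)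
    case empty
    then show ?case by (auto simp: mset_set_empty_iff bij_betw_def)
  next
    case (insert a A)
    then have "f a \<in># image_mset g (mset_set B)"
      by (metis image_mset_add_mset mset_set.insert union_single_eq_member)
    then obtain b where b: "b \<in> B" "g b = f a" using insert.prems by auto
    have "mset_set B = add_mset b (mset_set (B - {b}))"
      using b insert.prems by (simp add: mset_set.remove)
    then have "image_mset f (mset_set A) = image_mset g (mset_set (B - {b}))"
      using insert.prems insert.hyps b by simp
    then obtain h where h: "bij_betw h A (B - {b})" "\<forall>a\<in>A. g (h a) = f a"
      using insert.IH[of "B - {b}"] insert.prems by auto
    have "bij_betw (h(a := b)) (insert a A) (insert b (B - {b}))"
      using h(1) insert.hyps by (auto simp: bij_betw_def inj_on_def)
    moreover have "insert b (B - {b}) = B" using b by auto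
    moreover have "\<forall>c\<in>insert a A. g ((h(a := b)) c) = f c"
      using h(2) b insert.hyps by auto
    ultimately show ?case by metis
  qed
  then show ?thesis using that by blast
qed

definition rel_iso_on :: "('a \<Rightarrow> 'b) \<Rightarrow> 'a set \<Rightarrow> 'a rel \<Rightarrow> 'b set \<Rightarrow> 'b rel \<Rightarrow> bool" where
  "rel_iso_on f A R B S \<longleftrightarrow>
    bij_betw f A B \<and> (\<forall>a\<in>A. \<forall>b\<in>A. (a, b) \<in> R \<longleftrightarrow> (f a, f b) \<in> S)"

text \<open>Children with equal trees are paired, the induction hypothesis gives an isomorphism on
  each branch, and these are glued over the disjoint branches with the roots sent to each
  other.\<close>

lemma represents_same_imp_iso:
  assumes R: "single_valued (R\<inverse>)" "acyclic R" and R': "single_valued (R'\<inverse>)" "acyclic R'"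
    and "represents R v t" "represents R' v' t"
  shows "\<exists>f. f v = v' \<and> rel_iso_on f (R\<^sup>* `` {v}) R (R'\<^sup>* `` {v'}) R'"
  using assms(5,6)
proof (induction arbitrary: v' rule: represents.induct)
  case (represents_Node v g)
  let ?D = "\<lambda>w. R\<^sup>* `` {w}" and ?D' = "\<lambda>w. R'\<^sup>* `` {w}"
  from represents_Node.prems obtain g' where g': "finite (R' `` {v'})"
      "image_mset g (mset_set (R `` {v})) = image_mset g' (mset_set (R' `` {v'}))"
      "\<forall>w\<in>R' `` {v'}. represents R' w (g' w)"
    by cases auto
  obtain h where h: "bij_betw h (R `` {v}) (R' `` {v'})" "\<And>w. w \<in> R `` {v} \<Longrightarrow> g' (h w) = g w"
    using image_mset_eq_bij_betw[OF represents_Node.hyps(1) g'(1,2)] by blast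
  have hR: "(v', h w) \<in> R'" if "(v, w) \<in> R" for w
    using bij_betwE[OF h(1)] that by auto
  have "\<forall>w\<in>R `` {v}. \<exists>f. f w = h w \<and> rel_iso_on f (?D w) R (?D' (h w)) R'"
    using represents_Node g'(3) h hR by (metis Image_singleton_iff)
  then obtain F where F: "\<And>w. (v, w) \<in> R \<Longrightarrow> F w w = h w"
      "\<And>w. (v, w) \<in> R \<Longrightarrow> rel_iso_on (F w) (?D w) R (?D' (h w)) R'"
    by (metis Image_singleton_iff)
  \<comment> \<open>The description picks the branch containing \<open>x\<close>; it is well defined
    because branches of distinct children are disjoint.\<close>
  define f where "f x = (if x = v then v' else F (THE w. (v, w) \<in> R \<and> (w, x) \<in> R\<^sup>*) x)" for x
  have notv: "(w, v) \<notin> R\<^sup>*" if "(v, w) \<in> R" for w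
    using acyclic_no_parent_below[OF R(2) that] .
  have notv': "(w, v') \<notin> R'\<^sup>*" if "(v', w) \<in> R'" for w
    using acyclic_no_parent_below[OF R'(2) that] .
  have f: "f x = F w x" if "(v, w) \<in> R" "(w, x) \<in> R\<^sup>*" for w x
  proof -
    have "x \<noteq> v" using that notv by auto
    moreover have "(THE w. (v, w) \<in> R \<and> (w, x) \<in> R\<^sup>*) = w"
      using that rtrancl_Image_children_disjoint[OF R] by (intro the_equality) blast+
    ultimately show ?thesis by (simp add: f_def)
  qed
  have fv: "f v = v'" by (simp add: f_def)
  have bij_w: "bij_betw f (?D w) (?D' (h w))" if "w \<in> R `` {v}" for w
  proof -
    have "bij_betw (F w) (?D w) (?D' (h w))" using F(2) that by (simp add: rel_iso_on_def)
    then show ?thesis using f that by (subst bij_betw_cong[of _ _ "F w"]) auto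
  qed
  have below: "(h w, f x) \<in> R'\<^sup>*" if "(v, w) \<in> R" "(w, x) \<in> R\<^sup>*" for w x
    using bij_betwE[OF bij_w] that by auto
  have same: "w = u" if "(v, w) \<in> R" "(v, u) \<in> R" "(h w, y) \<in> R'\<^sup>*" "(h u, y) \<in> R'\<^sup>*" for w u y
    using rtrancl_Image_children_disjoint[OF R' hR hR] that h(1)
    by (metis Image_singleton_iff bij_betw_imp_inj_on inj_onD)
  have fh: "f w = h w" if "(v, w) \<in> R" for w
    using f[OF that] F(1)[OF that] by simp
  have "bij_betw f (\<Union>w\<in>R `` {v}. ?D w) (\<Union>w\<in>R `` {v}. ?D' (h w))"
  proof (rule bij_betw_UNION_disjoint)
    show "disjoint_family_on (\<lambda>w. ?D' (h w)) (R `` {v})"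
      using same by (auto simp: disjoint_family_on_def)
  qed (rule bij_w)
  moreover have "(\<Union>w\<in>R `` {v}. ?D' (h w)) = (\<Union>w\<in>R' `` {v'}. ?D' w)"
    unfolding bij_betw_imp_surj_on[OF h(1), symmetric] by (simp add: image_image)
  ultimately have "bij_betw f ({v} \<union> (\<Union>w\<in>R `` {v}. ?D w)) ({v'} \<union> (\<Union>w\<in>R' `` {v'}. ?D' w))"
    using fv notv' by (intro bij_betw_combine) auto
  then have bij: "bij_betw f (?D v) (?D' v')"
    unfolding rtrancl_Image_insert[of R v] rtrancl_Image_insert[of R' v'] by simp
  have "(a, b) \<in> R \<longleftrightarrow> (f a, f b) \<in> R'" if a: "a \<in> ?D v" and b: "b \<in> ?D v" for a b
  proof -
    consider (root) "b = v" | (below) u where "(v, u) \<in> R" "(u, b) \<in> R\<^sup>*"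
      using b by (auto elim: converse_rtranclE)
    then show ?thesis
    proof cases
      case root
      have "(v, a) \<in> R\<^sup>*" "(v', f a) \<in> R'\<^sup>*"
        using a bij_betwE[OF bij] by auto
      then show ?thesis
        using acyclic_no_parent_below[OF R(2)] acyclic_no_parent_below[OF R'(2)] root fv by blast
    next
      case u: below
      consider (root) "a = v" | (below) w where "(v, w) \<in> R" "(w, a) \<in> R\<^sup>*"
        using a by (auto elim: converse_rtranclE)
      then show ?thesis
      proof cases
        case root
        show ?thesis
        proof
          assume "(a, b) \<in> R"
          then show "(f a, f b) \<in> R'" using root fv fh hR by simp
        next
          assume "(f a, f b) \<in> R'"
          then have "f b \<in> h ` R `` {v}"
            using root fv h(1) by (simp add: bij_betw_def)
          then obtain c where c: "(v, c) \<in> R" "h c = f b" by auto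
          \<comment> \<open>The image of \<open>b\<close> is the child \<open>h c\<close> and also
            lies below \<open>h u\<close>, so the branches coincide; injectivity on that branch then
            shows that \<open>b\<close> is the child \<open>u\<close> itself.\<close>
          then have "c = u" using same[of c u "f b"] u below by auto
          then have "F u u = F u b" using c f[OF u] F(1) by simp
          then have "u = b"
            using F(2)[OF u(1)] u(2) by (auto simp: rel_iso_on_def bij_betw_def inj_on_def)
          then show "(a, b) \<in> R" using u root by simp
        qed
      next
        case w: below
        show ?thesis
        proof (cases "w = u")
          case True
          then show ?thesis
            using F(2)[OF w(1)] f[OF w] f[OF u] w u by (auto simp: rel_iso_on_def)
        next
          case False
          \<comment> \<open>An arc between two branches would put its end below two different
            children, on either side.\<close>
          then have "(a, b) \<notin> R"
            using rtrancl_Image_children_disjoint[OF R w(1) u(1)] w u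
            by (meson rtrancl.rtrancl_into_rtrancl)
          moreover have "(f a, f b) \<notin> R'"
            using same[OF w(1) u(1), of "f b"] below[OF w] below[OF u] False
            by (meson rtrancl.rtrancl_into_rtrancl)
          ultimately show ?thesis by simp
        qed
      qed
    qed
  qed
  with bij fv show ?case by (auto simp: rel_iso_on_def)
qed

section \<open>Graph-theoretic rooted trees\<close>

definition simple_path :: "'a rel \<Rightarrow> 'a \<Rightarrow> 'a list \<Rightarrow> 'a \<Rightarrow> bool" where
  "simple_path E u xs v \<longleftrightarrow>
    xs \<noteq> [] \<and> hd xs = u \<and> last xs = v \<and> distinct xs \<and> successively (\<lambda>a b. (a, b) \<in> E) xs"

definition polygon :: "'a rel \<Rightarrow> 'a list \<Rightarrow> bool" where
  "polygon E xs \<longleftrightarrow>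
    3 \<le> length xs \<and> distinct xs \<and> successively (\<lambda>a b. (a, b) \<in> E) xs \<and> (last xs, hd xs) \<in> E"

lemma polygon_rotate:
  assumes "polygon E (as @ bs)" "bs \<noteq> []"
  shows "polygon E (bs @ as)"
  using assms by (cases "as = []") (auto simp: polygon_def successively_append_iff)

lemma simple_path_ends_eq: "simple_path E u xs u \<Longrightarrow> xs = [u]"
  by (cases xs) (auto simp: simple_path_def split: if_splits)

text \<open>After a common beginning, two different paths diverge at some vertex and meet again; the
  two stretches up to the first meeting form a polygon.\<close>

lemma simple_path_unique:
  assumes sym: "sym E" and no: "\<nexists>zs. polygon E zs"
    and "simple_path E u xs v" "simple_path E u ys v"
  shows "xs = ys"
  using assms(3,4)
proof (induction xs arbitrary: u ys)
  case Nil
  then show ?case by (simp add: simple_path_def)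
next
  case (Cons u' xs)
  have [simp]: "u' = u" using Cons.prems by (simp add: simple_path_def)
  show ?case
  proof (cases "u = v")
    case True
    then show ?thesis using Cons.prems simple_path_ends_eq by metis
  next
    case False
    then have xs: "xs \<noteq> []" using Cons.prems by (auto simp: simple_path_def)
    obtain ys' where ys: "ys = u # ys'" "ys' \<noteq> []"
      using Cons.prems False by (cases ys; cases "tl ys") (auto simp: simple_path_def)
    have px: "simple_path E (hd xs) xs v" "(u, hd xs) \<in> E" "u \<notin> set xs"
      using Cons.prems xs by (auto simp: simple_path_def successively_Cons)
    have py: "simple_path E (hd ys') ys' v" "(u, hd ys') \<in> E" "u \<notin> set ys'"
      using Cons.prems ys by (auto simp: simple_path_def successively_Cons)
    show ?thesis
    proof (cases "hd xs = hd ys'")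
      case True
      then show ?thesis using Cons.IH px py ys by simp
    next
      case diff: False
      have "\<exists>x\<in>set xs. x \<in> set ys'"
        using px py by (metis last_in_set simple_path_def)
      \<comment> \<open>Taking the first vertex of \<open>xs\<close> that lies on the other path
        keeps \<open>as\<close> disjoint from it, so the closed walk has no repetition.\<close>
      then obtain as w bs where as: "xs = as @ w # bs" "w \<in> set ys'" "\<forall>z\<in>set as. z \<notin> set ys'"
        using split_list_first_prop[of xs "\<lambda>x. x \<in> set ys'"] by blast
      obtain cs ds where cs: "ys' = cs @ w # ds"
        using as(2) split_list by metis
      have "polygon E (u # as @ w # rev cs)"
      proof -
        \<comment> \<open>If both were empty, the second vertices would agree; this is what gives
          the polygon its third vertex.\<close>
        have "as \<noteq> [] \<or> cs \<noteq> []" using diff as cs by auto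
        then have "3 \<le> length (u # as @ w # rev cs)"
          by (cases as; cases cs) auto
        moreover have "distinct (u # as @ w # rev cs)"
          using px py as cs by (auto simp: simple_path_def)
        moreover have "successively (\<lambda>a b. (a, b) \<in> E) (u # as @ [w])"
          using px(1,2) as(1) by (auto simp: simple_path_def successively_append_iff successively_Cons hd_append)
        moreover have "successively (\<lambda>a b. (b, a) \<in> E) (cs @ [w])"
        proof -
          have "successively (\<lambda>a b. (a, b) \<in> E) (cs @ [w])"
            using py(1) cs by (auto simp: simple_path_def successively_append_iff)
          then show ?thesis by (rule successively_mono) (rule symD[OF sym])
        qed
        then have "successively (\<lambda>a b. (a, b) \<in> E) (w # rev cs)"
          by (subst (asm) successively_rev[symmetric]) simp
        moreover have "(last (w # rev cs), u) \<in> E"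
          using symD[OF sym py(2)] cs by (cases cs) auto
        ultimately show ?thesis
          by (auto simp: polygon_def successively_append_iff successively_Cons hd_append)
      qed
      then show ?thesis using no by blast
    qed
  qed
qed

lemma simple_path_exists: "(u, v) \<in> E\<^sup>* \<Longrightarrow> \<exists>xs. simple_path E u xs v"
proof (induction rule: rtrancl_induct)
  case base
  then show ?case by (intro exI[of _ "[u]"]) (simp add: simple_path_def)
next
  case (step y z)
  then obtain xs where xs: "simple_path E u xs y" by blast
  show ?case
  proof (cases "z \<in> set xs")
    case True
    then obtain as bs where "xs = as @ z # bs" using split_list by metis
    then have "simple_path E u (as @ [z]) z"
      using xs by (auto simp: simple_path_def successively_append_iff successively_Cons hd_append split: if_splits)
    then show ?thesis by blast
  next
    case False
    then have "simple_path E u (xs @ [z]) z"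
      using xs step by (auto simp: simple_path_def successively_append_iff)
    then show ?thesis by blast
  qed
qed

section \<open>Orientation of a tree away from its root\<close>

definition arborescence :: "'a rooted_graph \<Rightarrow> 'a rel \<Rightarrow> bool" where
  "arborescence T R \<longleftrightarrow> finite (pverts (fst T)) \<and> pverts (fst T) = R\<^sup>* `` {snd T} \<and>
     parcs (fst T) = R \<union> R\<inverse> \<and> Domain R \<subseteq> pverts (fst T) \<and>
     single_valued (R\<inverse>) \<and> snd T \<notin> Range R"

text \<open>A cycle through a vertex must enter it from its only parent, so it also passes through
  the parent; climbing on leads to the root, which has no parent.\<close>

lemma arborescence_acyclic:
  assumes "arborescence T R"
  shows "acyclic R"
proof -
  have sv: "single_valued (R\<inverse>)" and root: "snd T \<notin> Range R"
    and dom: "Domain R \<subseteq> R\<^sup>* `` {snd T}"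
    using assms by (auto simp: arborescence_def)
  have "(y, y) \<notin> R\<^sup>+" if "(snd T, y) \<in> R\<^sup>*" for y
    using that
  proof (induction rule: rtrancl_induct)
    case base
    then show ?case using root by (auto elim: tranclE)
  next
    case (step y z)
    show ?case
    proof
      assume "(z, z) \<in> R\<^sup>+"
      then obtain u where "(z, u) \<in> R\<^sup>*" "(u, z) \<in> R" by (auto dest: tranclD2)
      moreover have "u = y" using sv step \<open>(u, z) \<in> R\<close> by (auto simp: single_valued_def)
      ultimately show False using step by (meson rtrancl_into_trancl2)
    qed
  qed
  moreover have "x \<in> Domain R" if "(x, x) \<in> R\<^sup>+" for x
    using that by (auto dest: tranclD)
  ultimately show ?thesis using dom unfolding acyclic_def by blast
qed

lemma arborescence_in_verts:
  assumes "arborescence T R" "(u, v) \<in> R"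
  shows "u \<in> pverts (fst T)" "v \<in> pverts (fst T)"
proof -
  show "u \<in> pverts (fst T)" using assms by (auto simp: arborescence_def)
  then show "v \<in> pverts (fst T)" using assms by (auto simp: arborescence_def)
qed

lemma arborescence_finite:
  assumes "arborescence T R" shows "finite R"
  using assms arborescence_in_verts[OF assms]
  by (intro finite_subset[of R "pverts (fst T) \<times> pverts (fst T)"]) (auto simp: arborescence_def)

text \<open>The first upward step would return to the vertex just left, as that is the unique
  parent, or would leave the root towards a parent that it lacks.\<close>

lemma arborescence_path_downward:
  assumes T: "arborescence T R" and "successively (\<lambda>a b. (a, b) \<in> parcs (fst T)) xs"
    "distinct xs" "xs \<noteq> []" "hd xs = snd T"
  shows "successively (\<lambda>a b. (a, b) \<in> R) xs"
  using assms(2-)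
proof (induction xs rule: rev_induct)
  case (snoc c xs)
  show ?case
  proof (cases "xs = []")
    case False
    then have xs: "successively (\<lambda>a b. (a, b) \<in> R) xs" and hd: "hd xs = snd T"
      and E: "(last xs, c) \<in> parcs (fst T)" and c: "c \<notin> set xs"
      using snoc by (auto simp: successively_append_iff)
    have "(c, last xs) \<notin> R"
    proof
      assume cR: "(c, last xs) \<in> R"
      obtain ys b where ys: "xs = ys @ [b]" using False rev_exhaust by blast
      show False
      proof (cases "ys = []")
        case True
        then show ?thesis using T cR hd ys by (auto simp: arborescence_def)
      next
        case False
        then have "(last ys, b) \<in> R" using xs ys by (auto simp: successively_append_iff)
        then have "last ys = c" using T cR ys by (auto simp: arborescence_def single_valued_def)
        then show ?thesis using c ys False by auto
      qed
    qed
    then have "(last xs, c) \<in> R" using E T by (auto simp: arborescence_def)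
    then show ?thesis using xs by (simp add: successively_append_iff)
  qed simp
qed simp

lemma successively_trancl:
  assumes "successively (\<lambda>a b. (a, b) \<in> R) (x # xs)" "y \<in> set xs"
  shows "(x, y) \<in> R\<^sup>+"
  using assms
proof (induction xs arbitrary: x)
  case (Cons z zs)
  then show ?case
    by (cases "y = z") (auto intro: trancl_into_trancl2)
qed simp

lemma successively_acyclic_distinct:
  assumes "acyclic R" "successively (\<lambda>a b. (a, b) \<in> R) xs"
  shows "distinct xs"
  using assms(2)
proof (induction xs)
  case (Cons x xs)
  then show ?case
    using successively_trancl[of R x xs x] assms(1) by (auto simp: acyclic_def successively_Cons)
qed simp

text \<open>At a vertex of the polygon with no child on it, both neighbours would be parents, and
  they are distinct.\<close>

lemma arborescence_no_polygon:
  assumes T: "arborescence T R" shows "\<not> polygon (parcs (fst T)) xs"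
proof
  assume xs: "polygon (parcs (fst T)) xs"
  have "wf (R\<inverse>)"
    using finite_acyclic_wf_converse arborescence_finite[OF T] arborescence_acyclic[OF T] by blast
  moreover have "hd xs \<in> set xs" using xs by (intro hd_in_set) (auto simp: polygon_def)
  ultimately obtain w where w: "w \<in> set xs" "\<And>z. (w, z) \<in> R \<Longrightarrow> z \<notin> set xs"
    using wfE_min[of "R\<inverse>" "hd xs" "set xs"] by (metis converse_iff)
  obtain as bs where "xs = as @ w # bs" using w(1) split_list by metis
  then have rot: "polygon (parcs (fst T)) (w # bs @ as)"
    using polygon_rotate[of _ as "w # bs"] xs by simp
  have set: "set xs = set (w # bs @ as)" using \<open>xs = as @ w # bs\<close> by auto
  obtain y zs where ys: "bs @ as = y # zs" "zs \<noteq> []"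
    using rot by (cases "bs @ as") (auto simp: polygon_def Suc_le_eq)
  have "(w, y) \<in> parcs (fst T)" "(last zs, w) \<in> parcs (fst T)" "y \<noteq> last zs"
    using rot ys by (auto simp: polygon_def)
  moreover have "y \<in> set xs" "last zs \<in> set xs"
    using last_in_set[OF ys(2)] unfolding set ys by auto
  then have "(w, y) \<notin> R" "(w, last zs) \<notin> R" using w(2) by auto
  ultimately have "(y, w) \<in> R" "(last zs, w) \<in> R" "y \<noteq> last zs"
    using T by (auto simp: arborescence_def)
  then show False using T by (auto simp: arborescence_def single_valued_def)
qed

text \<open>The orientation is read off the unique simple paths from the root: an edge points to
  \<open>w\<close> when it is the last edge of the path to \<open>w\<close>.\<close>

lemma tree_relation_exists:
  assumes fin: "finite (pverts G)" and wf: "parcs G \<subseteq> pverts G \<times> pverts G"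
    and sym: "sym (parcs G)" and no: "\<nexists>xs. polygon (parcs G) xs"
    and irrefl: "\<And>v. (v, v) \<notin> parcs G" and r: "r \<in> pverts G" and conn: "\<And>v. v \<in> pverts G \<Longrightarrow> (r, v) \<in> (parcs G)\<^sup>*"
  shows "\<exists>R. arborescence (G, r) R"
proof -
  let ?E = "parcs G"
  define P where "P v = (THE xs. simple_path ?E r xs v)" for v
  have Peq: "P v = xs" if "simple_path ?E r xs v" for xs v
    unfolding P_def using that simple_path_unique[OF sym no] by (intro the_equality) auto
  have P: "simple_path ?E r (P v) v" if "v \<in> pverts G" for v
    using simple_path_exists[OF conn[OF that]] Peq by auto
  have lastP: "last (P v) = v" if "v \<in> pverts G" for v
    using P[OF that] by (simp add: simple_path_def)
  define R where "R = {(v, w). (v, w) \<in> ?E \<and> P w = P v @ [w]}"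
  have prefix: "P w = as @ [w]" if "v \<in> pverts G" "P v = as @ w # bs" for v w as bs
    using P[OF that(1)] that(2)
    by (intro Peq) (auto simp: simple_path_def successively_append_iff successively_Cons hd_append split: if_splits)
  have E: "?E = R \<union> R\<inverse>"
  proof
    show "R \<union> R\<inverse> \<subseteq> ?E" using sym by (auto simp: R_def dest: symD)
    show "?E \<subseteq> R \<union> R\<inverse>"
    proof (rule subrelI)
      fix v w assume vw: "(v, w) \<in> ?E"
      then have v: "v \<in> pverts G" and w: "w \<in> pverts G" using wf by auto
      \<comment> \<open>If \<open>w\<close> is not on the path to \<open>v\<close>, appending it
        gives the path to \<open>w\<close>. Otherwise the path to \<open>w\<close> is a prefix, and
        appending \<open>v\<close> to that prefix is again the unique path to
        \<open>v\<close>.\<close>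
      have "P w = P v @ [w] \<or> P v = P w @ [v]"
      proof (cases "w \<in> set (P v)")
        case False
        then have "simple_path ?E r (P v @ [w]) w"
          using P[OF v] vw by (auto simp: simple_path_def successively_append_iff)
        then show ?thesis using Peq by simp
      next
        case True
        then obtain as bs where Pv: "P v = as @ w # bs" using split_list by metis
        have Pw: "P w = as @ [w]" using prefix[OF v Pv] .
        have "v \<in> set bs"
          using Pv lastP[OF v] irrefl vw by (cases bs rule: rev_cases) auto
        then have "simple_path ?E r (P w @ [v]) v"
          using P[OF w] P[OF v] Pv Pw vw symD[OF sym vw]
          by (auto simp: simple_path_def successively_append_iff hd_append)
        then show ?thesis using Peq by simp
      qed
      then show "(v, w) \<in> R \<union> R\<inverse>"
        using vw symD[OF sym vw] by (auto simp: R_def)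
    qed
  qed
  have "(r, v) \<in> R\<^sup>*" if "v \<in> pverts G" for v
    using that
  proof (induction "length (P v)" arbitrary: v rule: less_induct)
    case less
    show ?case
    proof (cases "v = r")
      case False
      obtain xs where Pv: "P v = xs @ [v]"
        using P[OF less.prems] by (metis append_butlast_last_id simple_path_def)
      have "xs \<noteq> []" using Pv P[OF less.prems] False by (auto simp: simple_path_def)
      then obtain ys u where xs: "xs = ys @ [u]" using rev_exhaust by blast
      have uv: "(u, v) \<in> ?E"
        using P[OF less.prems] Pv xs by (auto simp: simple_path_def successively_append_iff)
      have "P u = xs" using prefix[OF less.prems, of ys u "[v]"] Pv xs by simp
      then have "(u, v) \<in> R" using uv Pv by (simp add: R_def)
      moreover have "(r, u) \<in> R\<^sup>*"
        using less.hyps[of u] \<open>P u = xs\<close> Pv uv wf by auto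
      ultimately show ?thesis by simp
    qed simp
  qed
  moreover have "v \<in> pverts G" if "(r, v) \<in> R\<^sup>*" for v
    using that r wf by (cases rule: rtranclE) (auto simp: R_def)
  ultimately have "pverts G = R\<^sup>* `` {r}" by auto
  moreover have "Domain R \<subseteq> pverts G" using wf by (auto simp: R_def)
  moreover have "single_valued (R\<inverse>)"
  proof (rule single_valuedI)
    fix w u v assume "(w, u) \<in> R\<inverse>" "(w, v) \<in> R\<inverse>"
    then have "P u = P v" "u \<in> pverts G" "v \<in> pverts G" using wf by (auto simp: R_def)
    then show "u = v" using lastP by metis
  qed
  moreover have "r \<notin> Range R"
  proof
    assume "r \<in> Range R"
    then obtain u where "P r = P u @ [r]" "u \<in> pverts G" using wf by (auto simp: R_def)
    moreover have "P r = [r]" by (rule simple_path_ends_eq[OF P[OF r]])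
    ultimately show False using P[of u] by (simp add: simple_path_def)
  qed
  ultimately show ?thesis
    using fin E by (auto simp: arborescence_def intro!: exI[of _ R])
qed

section \<open>Walks, paths and cycles of the digraph library as vertex lists\<close>

lemma awalk_successively:
  assumes "pre_digraph.awalk (with_proj G) u p v"
  shows "hd (pawalk_verts u p) = u" "last (pawalk_verts u p) = v" "pawalk_verts u p \<noteq> []"
    "successively (\<lambda>a b. (a, b) \<in> parcs G) (pawalk_verts u p)"
proof -
  have "set p \<subseteq> parcs G" "pcas u p v" using assms by (auto simp: pre_digraph.awalk_def cas_with_proj_eq)
  then have "hd (pawalk_verts u p) = u \<and> last (pawalk_verts u p) = v \<and> pawalk_verts u p \<noteq> []
      \<and> successively (\<lambda>a b. (a, b) \<in> parcs G) (pawalk_verts u p)"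
    by (induction p arbitrary: u) (auto simp: successively_Cons)
  then show "hd (pawalk_verts u p) = u" "last (pawalk_verts u p) = v" "pawalk_verts u p \<noteq> []"
    "successively (\<lambda>a b. (a, b) \<in> parcs G) (pawalk_verts u p)" by auto
qed

lemma successively_awalk:
  assumes "successively (\<lambda>a b. (a, b) \<in> parcs G) xs" "xs \<noteq> []" "hd xs \<in> pverts G"
  shows "pre_digraph.awalk (with_proj G) (hd xs) (zip xs (tl xs)) (last xs)"
    "pawalk_verts (hd xs) (zip xs (tl xs)) = xs"
proof -
  have "set (zip xs (tl xs)) \<subseteq> parcs G \<and> pcas (hd xs) (zip xs (tl xs)) (last xs)
      \<and> pawalk_verts (hd xs) (zip xs (tl xs)) = xs"
    using assms(1,2)
  proof (induction xs)
    case (Cons x xs)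
    then show ?case by (cases xs) auto
  qed simp
  then show "pre_digraph.awalk (with_proj G) (hd xs) (zip xs (tl xs)) (last xs)"
    "pawalk_verts (hd xs) (zip xs (tl xs)) = xs"
    using assms(3) by (auto simp: pre_digraph.awalk_def cas_with_proj_eq)
qed

text \<open>The arbitrary property \<open>Q\<close> of the vertex sequence is carried along because
  \<open>limb_verts\<close> asks for a vertex on the path.\<close>

lemma apath_iff_simple_path:
  assumes "u \<in> pverts G"
  shows "(\<exists>p. pre_digraph.apath (with_proj G) u p w \<and> Q (pre_digraph.awalk_verts (with_proj G) u p))
    \<longleftrightarrow> (\<exists>xs. simple_path (parcs G) u xs w \<and> Q xs)"
proof
  assume "\<exists>p. pre_digraph.apath (with_proj G) u p w \<and> Q (pre_digraph.awalk_verts (with_proj G) u p)"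
  then show "\<exists>xs. simple_path (parcs G) u xs w \<and> Q xs"
    using awalk_successively[of G u _ w]
    by (fastforce simp: pre_digraph.apath_def simple_path_def awalk_verts_with_proj_eq)
next
  assume "\<exists>xs. simple_path (parcs G) u xs w \<and> Q xs"
  then obtain xs where xs: "simple_path (parcs G) u xs w" "Q xs" by blast
  then have "pre_digraph.apath (with_proj G) u (zip xs (tl xs)) w
      \<and> pawalk_verts u (zip xs (tl xs)) = xs"
    using successively_awalk[of G xs] assms
    by (auto simp: pre_digraph.apath_def simple_path_def awalk_verts_with_proj_eq)
  then show "\<exists>p. pre_digraph.apath (with_proj G) u p w \<and> Q (pre_digraph.awalk_verts (with_proj G) u p)"
    using xs(2) by (auto simp: awalk_verts_with_proj_eq)
qed

lemma length_pawalk_verts: "length (pawalk_verts u p) = Suc (length p)"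
  by (induction p arbitrary: u) auto

text \<open>The vertex list of a closed walk repeats its start at the end. Dropping the head gives
  the polygon, appending the first vertex gives the walk back, and the number of arcs equals the
  number of polygon vertices.\<close>

lemma long_cycle_iff_polygon:
  assumes "parcs G \<subseteq> pverts G \<times> pverts G"
  shows "(\<exists>c. pre_digraph.cycle (with_proj G) c \<and> 3 \<le> length c) \<longleftrightarrow> (\<exists>xs. polygon (parcs G) xs)"
proof
  assume "\<exists>c. pre_digraph.cycle (with_proj G) c \<and> 3 \<le> length c"
  then obtain c u where c: "pre_digraph.awalk (with_proj G) u c u"
      "distinct (tl (pawalk_verts u c))" "3 \<le> length c"
    by (auto simp: pre_digraph.cycle_def awalk_verts_with_proj_eq)
  obtain xs where xs: "pawalk_verts u c = u # xs"
    using awalk_successively(1,3)[OF c(1)] by (metis list.collapse)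
  have "xs \<noteq> []" "3 \<le> length xs"
    using length_pawalk_verts[of u c] xs c(3) by auto
  then have "polygon (parcs G) xs"
    using awalk_successively(2,4)[OF c(1)] xs c(2) by (auto simp: polygon_def successively_Cons)
  then show "\<exists>xs. polygon (parcs G) xs" by blast
next
  assume "\<exists>xs. polygon (parcs G) xs"
  then obtain xs where xs: "polygon (parcs G) xs" by blast
  then obtain x ys where x: "xs = x # ys" by (cases xs) (auto simp: polygon_def)
  let ?zs = "xs @ [x]"
  have "successively (\<lambda>a b. (a, b) \<in> parcs G) ?zs" "x \<in> pverts G"
    using xs x assms by (auto simp: polygon_def successively_append_iff simp del: append_Cons)
  then have "pre_digraph.awalk (with_proj G) x (zip ?zs (tl ?zs)) x"
      "pawalk_verts x (zip ?zs (tl ?zs)) = ?zs"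
    using successively_awalk[of G ?zs] x by auto
  moreover have "distinct (tl ?zs)" "length (zip ?zs (tl ?zs)) = length xs"
    using xs x by (auto simp: polygon_def)
  moreover have "3 \<le> length xs" using xs by (simp add: polygon_def)
  ultimately have "pre_digraph.cycle (with_proj G) (zip ?zs (tl ?zs)) \<and> 3 \<le> length (zip ?zs (tl ?zs))"
    by (auto simp: pre_digraph.cycle_def awalk_verts_with_proj_eq intro!: exI[of _ x])
  then show "\<exists>c. pre_digraph.cycle (with_proj G) c \<and> 3 \<le> length c" by blast
qed

text \<open>Library connectedness means strong connectedness of the symmetric closure, which changes
  nothing here.\<close>

lemma mk_symmetric_with_proj:
  assumes "sym (parcs G)" shows "mk_symmetric (with_proj G) = G"
  using assms by (intro pair_pre_digraph.equality) (auto simp: parcs_mk_symmetric dest: symD)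

lemma rooted_tree_imp_arborescence:
  assumes "rooted_tree T"
  shows "\<exists>R. arborescence T R"
proof -
  interpret pair_graph "fst T" using assms by (simp add: rooted_tree_def)
  have sym: "sym (parcs (fst T))" using pair_sym_arcs by (simp add: symmetric_def)
  have wf: "parcs (fst T) \<subseteq> pverts (fst T) \<times> pverts (fst T)"
    using wellformed' by auto
  have root: "snd T \<in> pverts (fst T)" using assms by (simp add: rooted_tree_def)
  have "(snd T, v) \<in> (parcs (fst T))\<^sup>*" if "v \<in> pverts (fst T)" for v
  proof -
    have "strongly_connected (with_proj (fst T))"
      using assms mk_symmetric_with_proj[OF sym]
      by (simp add: rooted_tree_def Digraph_Component.connected_def)
    then have "(snd T) \<rightarrow>\<^sup>*\<^bsub>with_proj (fst T)\<^esub> v"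
      using root that by (auto simp: strongly_connected_def)
    then show ?thesis using reachable_rtranclI by auto
  qed
  then have "\<exists>R. arborescence (fst T, snd T) R"
    using pair_finite_verts wf sym root assms long_cycle_iff_polygon[OF wf] no_loops'
    by (intro tree_relation_exists) (auto simp: rooted_tree_def dest: no_loops')
  then show ?thesis by simp
qed

lemma arborescence_imp_rooted_tree:
  assumes T: "arborescence T R"
  shows "rooted_tree T"
proof -
  have E: "parcs (fst T) = R \<union> R\<inverse>" using T by (simp add: arborescence_def)
  have wf: "parcs (fst T) \<subseteq> pverts (fst T) \<times> pverts (fst T)"
    using arborescence_in_verts[OF T] by (auto simp: E)
  have sym: "sym (parcs (fst T))" by (auto simp: E sym_def)
  have graph: "pair_graph (fst T)"
  proof unfold_locales
    fix e assume e: "e \<in> parcs (fst T)"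
    then show "fst e \<in> pverts (fst T)" "snd e \<in> pverts (fst T)" using wf by auto
    show "fst e \<noteq> snd e"
      using e arborescence_acyclic[OF T] by (cases e) (auto simp: E acyclic_def)
  next
    show "finite (pverts (fst T))" using T unfolding arborescence_def by blast
    show "finite (parcs (fst T))" using arborescence_finite[OF T] by (simp add: E)
    show "symmetric (with_proj (fst T))" using sym by (simp add: symmetric_def)
  qed
  then interpret pair_graph "fst T" .
  have reach: "(snd T) \<rightarrow>\<^sup>*\<^bsub>with_proj (fst T)\<^esub> v" if "(snd T, v) \<in> R\<^sup>*" for v
    using that
  proof (induction rule: rtrancl_induct)
    case base
    then show ?case using T by (auto simp: arborescence_def)
  next
    case (step y z)
    then show ?case using E by (auto intro: reachable_adj_trans)
  qed
  have "strongly_connected (with_proj (fst T))"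
  proof (rule strongly_connectedI)
    show "verts (with_proj (fst T)) \<noteq> {}" using T by (auto simp: arborescence_def)
    fix u v assume "u \<in> verts (with_proj (fst T))" "v \<in> verts (with_proj (fst T))"
    then have "(snd T) \<rightarrow>\<^sup>*\<^bsub>with_proj (fst T)\<^esub> u" "(snd T) \<rightarrow>\<^sup>*\<^bsub>with_proj (fst T)\<^esub> v"
      using T reach by (auto simp: arborescence_def)
    then show "u \<rightarrow>\<^sup>*\<^bsub>with_proj (fst T)\<^esub> v"
      using symmetric_reachable[OF pair_sym_arcs] reachable_trans by blast
  qed
  moreover have "\<nexists>c. pre_digraph.cycle (with_proj (fst T)) c \<and> 3 \<le> length c"
    unfolding long_cycle_iff_polygon[OF wf] using arborescence_no_polygon[OF T] by blast
  moreover have "snd T \<in> pverts (fst T)" using T by (auto simp: arborescence_def)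
  ultimately show ?thesis
    using graph mk_symmetric_with_proj[OF sym]
    by (simp add: rooted_tree_def Digraph_Component.connected_def)
qed

section \<open>Maximal limbs as sets of descendants\<close>

lemma rtrancl_successively:
  assumes "(u, v) \<in> R\<^sup>*"
  shows "\<exists>xs. xs \<noteq> [] \<and> hd xs = u \<and> last xs = v \<and> successively (\<lambda>a b. (a, b) \<in> R) xs"
  using simple_path_exists[OF assms] by (auto simp: simple_path_def)

lemma successively_rtrancl:
  assumes "successively (\<lambda>a b. (a, b) \<in> R) xs" "x \<in> set xs"
  shows "(x, last xs) \<in> R\<^sup>*"
proof -
  obtain as bs where xs: "xs = as @ x # bs" using assms(2) split_list by metis
  then have "successively (\<lambda>a b. (a, b) \<in> R) (x # bs)"
    using assms(1) by (simp add: successively_append_iff)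
  then show ?thesis
    using successively_trancl[of R x bs "last bs"] xs by (auto intro: trancl_into_rtrancl)
qed

lemma limb_verts_arborescence:
  assumes T: "arborescence T R" and v: "v \<in> pverts (fst T)"
  shows "limb_verts T v = R\<^sup>* `` {v}"
proof -
  have root: "snd T \<in> pverts (fst T)" and E: "R \<subseteq> parcs (fst T)"
    using T by (auto simp: arborescence_def)
  have "limb_verts T v = {w. \<exists>xs. simple_path (parcs (fst T)) (snd T) xs w \<and> v \<in> set xs}"
    unfolding limb_verts_def
    using apath_iff_simple_path[OF root, where Q = "\<lambda>xs. v \<in> set xs"] by simp
  also have "\<dots> = R\<^sup>* `` {v}"
  proof (intro equalityI subsetI)
    fix w assume "w \<in> {w. \<exists>xs. simple_path (parcs (fst T)) (snd T) xs w \<and> v \<in> set xs}"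
    then show "w \<in> R\<^sup>* `` {v}"
      using arborescence_path_downward[OF T] successively_rtrancl by (fastforce simp: simple_path_def)
  next
    fix w assume "w \<in> R\<^sup>* `` {v}"
    then obtain ys where ys: "ys \<noteq> []" "hd ys = v" "last ys = w" "successively (\<lambda>a b. (a, b) \<in> R) ys"
      using rtrancl_successively[of v w R] by auto
    obtain xs where xs: "xs \<noteq> []" "hd xs = snd T" "last xs = v" "successively (\<lambda>a b. (a, b) \<in> R) xs"
      using rtrancl_successively[of "snd T" v R] T v by (auto simp: arborescence_def)
    \<comment> \<open>The vertex \<open>v\<close> ends \<open>xs\<close> and begins
      \<open>ys\<close>, so one copy is dropped. Acyclicity then makes the joined downward walk free
      of repetitions.\<close>
    let ?zs = "butlast xs @ ys"
    have "xs = butlast xs @ [v]" using xs by (metis append_butlast_last_id)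
    then have succ: "successively (\<lambda>a b. (a, b) \<in> R) ?zs" and hd: "hd ?zs = snd T"
      using xs ys by (metis successively_append_iff list.sel(1) not_Cons_self2, metis hd_append list.sel(1))
    have "simple_path (parcs (fst T)) (snd T) ?zs w"
      using succ hd ys successively_acyclic_distinct[OF arborescence_acyclic[OF T] succ] E
      by (auto simp: simple_path_def elim!: successively_mono)
    moreover have "v \<in> set ?zs" using ys by auto
    ultimately show "w \<in> {w. \<exists>xs. simple_path (parcs (fst T)) (snd T) xs w \<and> v \<in> set xs}"
      by blast
  qed
  finally show ?thesis .
qed

lemma rtrancl_restrict_Image:
  "(R \<inter> (R\<^sup>* `` {v}) \<times> (R\<^sup>* `` {v}))\<^sup>* `` {v} = R\<^sup>* `` {v}"
proof -
  let ?R = "R \<inter> (R\<^sup>* `` {v}) \<times> (R\<^sup>* `` {v})"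
  have "(v, w) \<in> ?R\<^sup>*" if "(v, w) \<in> R\<^sup>*" for w
    using that
  proof (induction rule: rtrancl_induct)
    case (step y z)
    then have "(y, z) \<in> ?R" by auto
    with step.IH show ?case by (rule rtrancl_into_rtrancl)
  qed simp
  moreover have "?R\<^sup>* \<subseteq> R\<^sup>*" by (rule rtrancl_mono) auto
  ultimately show ?thesis by auto
qed

lemma arborescence_maximal_limb:
  assumes T: "arborescence T R" and v: "v \<in> pverts (fst T)"
  shows "arborescence (maximal_limb T v) (R \<inter> (R\<^sup>* `` {v}) \<times> (R\<^sup>* `` {v}))"
proof -
  let ?S = "R\<^sup>* `` {v}"
  let ?R = "R \<inter> ?S \<times> ?S"
  have "?S \<subseteq> pverts (fst T)"
    using T v by (auto simp: arborescence_def)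
  then have fin: "finite ?S" using T finite_subset by (auto simp: arborescence_def)
  have "v \<notin> Range ?R"
    using acyclic_no_parent_below[OF arborescence_acyclic[OF T]] by auto
  moreover have "single_valued (?R\<inverse>)"
    using T by (auto simp: arborescence_def single_valued_def)
  moreover have "{e \<in> parcs (fst T). fst e \<in> ?S \<and> snd e \<in> ?S} = ?R \<union> ?R\<inverse>"
    using T by (auto simp: arborescence_def)
  moreover have "?S = ?R\<^sup>* `` {v}" by (simp add: rtrancl_restrict_Image)
  ultimately show ?thesis
    unfolding arborescence_def maximal_limb_def limb_verts_arborescence[OF T v]
    using fin by auto
qed

section \<open>Isomorphism classes of graphs coded by nested multisets\<close>

text \<open>The orientation stays existential; that \<open>t\<close> is determined by
  \<open>T\<close> comes out of \<open>rooted_iso_iff_encodes_eq\<close> applied to the identity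
  isomorphism.\<close>

definition encodes :: "'a rooted_graph \<Rightarrow> rtree \<Rightarrow> bool" where
  "encodes T t \<longleftrightarrow> (\<exists>R. arborescence T R \<and> represents R (snd T) t)"

lemma encodes_exists:
  assumes "rooted_tree T" obtains t where "encodes T t"
  using rooted_tree_imp_arborescence[OF assms] arborescence_finite arborescence_acyclic
    represents_exists unfolding encodes_def by metis

lemma encodes_rooted_tree: "encodes T t \<Longrightarrow> rooted_tree T"
  unfolding encodes_def using arborescence_imp_rooted_tree by blast

lemma encodes_card:
  assumes "encodes T t" shows "card (pverts (fst T)) = nverts t"
proof -
  obtain R where R: "arborescence T R" "represents R (snd T) t"
    using assms by (auto simp: encodes_def)
  then show ?thesis
    using nverts_represents[OF _ arborescence_acyclic[OF R(1)] R(2)] by (auto simp: arborescence_def)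
qed

text \<open>Only undirected edges and the root are preserved by assumption. Going down from the
  root, a reversed image arc would give the image of \<open>b\<close> a second parent; it must be
  the image of \<open>a\<close>, so the child of \<open>b\<close> would be its own parent
  \<open>a\<close>.\<close>

lemma iso_preserves_arborescence:
  assumes S: "arborescence S R" and T: "arborescence T R'"
    and bij: "bij_betw f (pverts (fst S)) (pverts (fst T))" and root: "f (snd S) = snd T"
    and E: "\<forall>u \<in> pverts (fst S). \<forall>v \<in> pverts (fst S).
      (u, v) \<in> parcs (fst S) \<longleftrightarrow> (f u, f v) \<in> parcs (fst T)"
    and uv: "(u, v) \<in> R"
  shows "(f u, f v) \<in> R'"
proof -
  have sv: "single_valued (R'\<inverse>)" and ES: "parcs (fst S) = R \<union> R\<inverse>" and ET: "parcs (fst T) = R' \<union> R'\<inverse>"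
    using S T by (auto simp: arborescence_def)
  have edge: "(f a, f b) \<in> R' \<or> (f b, f a) \<in> R'" if "(a, b) \<in> R" for a b
    using E arborescence_in_verts[OF S that] that by (auto simp: ES ET)
  have "(snd S, u) \<in> R\<^sup>*" using S arborescence_in_verts(1)[OF S uv] by (auto simp: arborescence_def)
  then show ?thesis
    using uv
  proof (induction arbitrary: v rule: rtrancl_induct)
    case base
    have "(f v, f (snd S)) \<notin> R'" using T root by (auto simp: arborescence_def)
    then show ?case using edge base by blast
  next
    case (step a b)
    have "(f v, f b) \<notin> R'"
    proof
      assume "(f v, f b) \<in> R'"
      then have "f v = f a" using step sv by (auto simp: single_valued_def)
      then have "v = a"
        using bij arborescence_in_verts[OF S] step by (auto simp: bij_betw_def inj_on_def)
      then show False
        using step arborescence_acyclic[OF S] by (meson acyclic_no_parent_below r_into_rtrancl)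
    qed
    then show ?case using edge step by blast
  qed
qed

text \<open>An isomorphism respects orientations and so transports the represented tree. Conversely,
  equal trees give an isomorphism of the relations, and the edges are their symmetric
  closures.\<close>

lemma rooted_iso_iff_encodes_eq:
  assumes "encodes S s" "encodes T t"
  shows "rooted_iso S T \<longleftrightarrow> s = t"
proof -
  obtain R where S: "arborescence S R" "represents R (snd S) s"
    using assms by (auto simp: encodes_def)
  obtain R' where T: "arborescence T R'" "represents R' (snd T) t"
    using assms by (auto simp: encodes_def)
  have VS: "pverts (fst S) = R\<^sup>* `` {snd S}" and VT: "pverts (fst T) = R'\<^sup>* `` {snd T}"
    and ES: "parcs (fst S) = R \<union> R\<inverse>" and ET: "parcs (fst T) = R' \<union> R'\<inverse>"
    and sv: "single_valued (R\<inverse>)" "single_valued (R'\<inverse>)"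
    using S T by (auto simp: arborescence_def)
  show ?thesis
  proof
    assume "rooted_iso S T"
    then obtain f where f: "bij_betw f (pverts (fst S)) (pverts (fst T))"
        "\<forall>u \<in> pverts (fst S). \<forall>v \<in> pverts (fst S).
          (u, v) \<in> parcs (fst S) \<longleftrightarrow> (f u, f v) \<in> parcs (fst T)"
        "f (snd S) = snd T"
      by (auto simp: rooted_iso_def)
    have forward: "(f u, f v) \<in> R'" if "(u, v) \<in> R" for u v
      using iso_preserves_arborescence[OF S(1) T(1) f(1,3,2) that] .
    have "R' `` {f a} = f ` (R `` {a})" if a: "a \<in> pverts (fst S)" for a
    proof
      show "f ` (R `` {a}) \<subseteq> R' `` {f a}" using forward by auto
      show "R' `` {f a} \<subseteq> f ` (R `` {a})"
      proof
        fix y assume "y \<in> R' `` {f a}"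
        then have y: "(f a, y) \<in> R'" by simp
        then have "y \<in> f ` pverts (fst S)"
          using arborescence_in_verts(2)[OF T(1)] bij_betw_imp_surj_on[OF f(1)] by metis
        then obtain b where b: "b \<in> pverts (fst S)" "y = f b" by blast
        then have "(a, b) \<in> R \<or> (b, a) \<in> R" using f(2) a y by (auto simp: ES ET)
        moreover have "(b, a) \<notin> R"
          using forward y b acyclic_no_parent_below[OF arborescence_acyclic[OF T(1)] y]
          by auto
        ultimately show "y \<in> f ` (R `` {a})" using b by auto
      qed
    qed
    then have "represents R' (f (snd S)) s"
      using f(1) by (intro represents_map[OF S(2), where V = "pverts (fst S)"])
        (auto simp: VS bij_betw_def)
    then show "s = t" using represents_unique T(2) f(3) by metis
  next
    assume "s = t"
    then obtain f where f: "f (snd S) = snd T" "rel_iso_on f (pverts (fst S)) R (pverts (fst T)) R'"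
      using represents_same_imp_iso[OF sv(1) arborescence_acyclic[OF S(1)] sv(2)
          arborescence_acyclic[OF T(1)] S(2)] T(2) VS VT by metis
    then show "rooted_iso S T"
      unfolding rooted_iso_def rel_iso_on_def by (intro exI[of _ f]) (auto simp: ES ET)
  qed
qed

lemma has_maximal_limb_iff:
  assumes "encodes T t" "encodes L l"
  shows "has_maximal_limb T L \<longleftrightarrow> l \<in> limbs t"
proof -
  obtain R where T: "arborescence T R" "represents R (snd T) t"
    using assms by (auto simp: encodes_def)
  have V: "pverts (fst T) = R\<^sup>* `` {snd T}" using T by (simp add: arborescence_def)
  have limb: "rooted_iso (maximal_limb T v) L \<longleftrightarrow> represents R v l" if v: "v \<in> pverts (fst T)" for v
  proof -
    obtain s where s: "represents R v s"
      using represents_exists arborescence_finite arborescence_acyclic T(1) by metis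
    then have "encodes (maximal_limb T v) s"
      using arborescence_maximal_limb[OF T(1) v] represents_restrict[OF s order_refl]
      by (auto simp: encodes_def maximal_limb_def)
    then have "rooted_iso (maximal_limb T v) L \<longleftrightarrow> s = l"
      using assms(2) by (rule rooted_iso_iff_encodes_eq)
    then show ?thesis using s represents_unique by metis
  qed
  show ?thesis
    using limb unfolding has_maximal_limb_def limbs_represents[OF T(2)] V by auto
qed

text \<open>A new root is placed above disjoint copies of graphs for the children. Listing the
  multiset gives every occurrence of a repeated child its own index and hence its own copy.\<close>

lemma nat_graph_exists: "\<exists>T :: nat rooted_graph. encodes T t"
proof (induction t)
  case (Node M)
  obtain cs where cs: "M = mset cs" using ex_mset by metis
  define n where "n = length cs"
  have "\<forall>i\<in>{..<n}. \<exists>T :: nat rooted_graph. \<exists>Q. arborescence T Q \<and> represents Q (snd T) (cs ! i)"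
    using Node by (auto simp: cs n_def encodes_def)
  then obtain T :: "nat \<Rightarrow> nat rooted_graph" and Q where
    T: "\<And>i. i < n \<Longrightarrow> arborescence (T i) (Q i)" and
    rep: "\<And>i. i < n \<Longrightarrow> represents (Q i) (snd (T i)) (cs ! i)"
    by (metis lessThan_iff)
  \<comment> \<open>Pair coding separates the copies, and the successor keeps 0 free for the new
    root.\<close>
  define e where "e i x = Suc (prod_encode (i, x))" for i x :: nat
  have e_eq: "e i x = e j y \<longleftrightarrow> i = j \<and> x = y" and e0: "e i x \<noteq> 0" "0 \<noteq> e i x" for i j x y
    by (auto simp: e_def)
  define R where "R = {(0, e i (snd (T i))) |i. i < n} \<union> {(e i a, e i b) |i a b. i < n \<and> (a, b) \<in> Q i}"
  have R0: "R `` {0} = (\<lambda>i. e i (snd (T i))) ` {..<n}"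
    by (auto simp: R_def e0)
  have Re: "R `` {e i a} = e i ` (Q i `` {a})" if "i < n" for i a
    using that by (auto simp: R_def e0 e_eq)
  have lift: "(e i a, e i b) \<in> R\<^sup>*" if "i < n" "(a, b) \<in> (Q i)\<^sup>*" for i a b
    using that(2)
  proof (induction rule: rtrancl_induct)
    case (step y z)
    then have "(e i y, e i z) \<in> R" using that(1) by (auto simp: R_def)
    with step.IH show ?case by (rule rtrancl_into_rtrancl)
  qed simp
  have from_root: "(0, e i a) \<in> R\<^sup>*" if "i < n" "a \<in> pverts (fst (T i))" for i a
  proof -
    have "(0, e i (snd (T i))) \<in> R" using that by (auto simp: R_def)
    moreover have "(e i (snd (T i)), e i a) \<in> R\<^sup>*"
      using that T[OF that(1)] by (intro lift) (auto simp: arborescence_def)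
    ultimately show ?thesis by (rule converse_rtrancl_into_rtrancl)
  qed
  have root_in: "snd (T i) \<in> pverts (fst (T i))" if "i < n" for i
    using T[OF that] by (simp add: arborescence_def)
  have "R \<subseteq> UNIV \<times> (\<Union>i<n. e i ` pverts (fst (T i)))"
    using root_in arborescence_in_verts[OF T] by (fastforce simp: R_def)
  then have "R\<^sup>* `` {0} \<subseteq> insert 0 (\<Union>i<n. e i ` pverts (fst (T i)))"
    by (auto elim: rtranclE)
  moreover have "finite (\<Union>i<n. e i ` pverts (fst (T i)))"
    using T unfolding arborescence_def by blast
  ultimately have "finite (R\<^sup>* `` {0})" by (meson finite.insertI finite_subset)
  moreover have "Domain R \<subseteq> R\<^sup>* `` {0}"
    using from_root arborescence_in_verts(1)[OF T] by (auto simp: R_def)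
  moreover have "single_valued (R\<inverse>)"
    using T by (fastforce simp: R_def single_valued_def arborescence_def e0 e_eq)
  moreover have "0 \<notin> Range R" by (auto simp: R_def e0)
  ultimately have "arborescence (\<lparr>pverts = R\<^sup>* `` {0}, parcs = R \<union> R\<inverse>\<rparr>, 0) R"
    by (auto simp: arborescence_def)
  moreover have "represents R 0 (Node M)"
  proof -
    define f where "f w = cs ! fst (prod_decode (w - 1))" for w
    have f: "f (e i x) = cs ! i" for i x by (simp add: f_def e_def)
    have "represents R (e i (snd (T i))) (cs ! i)" if "i < n" for i
    proof (rule represents_map[OF rep[OF that]])
      show "inj_on (e i) UNIV" by (auto simp: inj_on_def e_eq)
    qed (use Re[OF that] in auto)
    then have "represents R 0 (Node (image_mset f (mset_set (R `` {0}))))"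
      by (intro represents_Node) (auto simp: R0 f)
    also have "mset_set (R `` {0}) = image_mset (\<lambda>i. e i (snd (T i))) (mset_set {..<n})"
      unfolding R0 by (subst image_mset_mset_set) (auto simp: inj_on_def e_eq)
    also have "image_mset f \<dots> = image_mset ((!) cs) (mset_set {0..<n})"
      by (simp add: multiset.map_comp comp_def f lessThan_atLeast0)
    also have "\<dots> = mset (map ((!) cs) [0..<n])" by simp
    also have "\<dots> = M" by (simp add: cs n_def map_nth)
    finally show ?thesis .
  qed
  ultimately show ?case by (auto simp: encodes_def)
qed

text \<open>The classes are the fibres of \<open>encodes\<close> over single nested multisets. Each
  fibre is nonempty by \<open>nat_graph_exists\<close>, so different multisets give different
  classes.\<close>

lemma card_quotient_rooted_iso:
  assumes Q: "\<And>T t. encodes T t \<Longrightarrow> Q T \<longleftrightarrow> Q' t"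
  shows "card ({T \<in> rooted_trees n. Q T} // rooted_iso_rel) = card {t. nverts t = n \<and> Q' t}"
proof -
  define cls where "cls t = {T :: nat rooted_graph. encodes T t}" for t
  have cls: "rooted_iso_rel `` {T} = cls t" if "encodes T t" for T t
  proof -
    have "(T, S) \<in> rooted_iso_rel \<longleftrightarrow> encodes S t" for S
      using that rooted_iso_iff_encodes_eq[OF that] encodes_rooted_tree encodes_exists
      unfolding rooted_iso_rel_def by (metis (no_types, lifting) case_prodI case_prodD mem_Collect_eq)
    then show ?thesis by (auto simp: cls_def)
  qed
  have "{T \<in> rooted_trees n. Q T} // rooted_iso_rel = cls ` {t. nverts t = n \<and> Q' t}"
  proof (intro equalityI subsetI)
    fix X assume "X \<in> {T \<in> rooted_trees n. Q T} // rooted_iso_rel"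
    then obtain T where T: "T \<in> rooted_trees n" "Q T" "X = rooted_iso_rel `` {T}"
      by (auto elim: quotientE)
    then have "rooted_tree T" "card (pverts (fst T)) = n" by (simp_all add: rooted_trees_def)
    moreover from this obtain t where t: "encodes T t" using encodes_exists by blast
    ultimately have "nverts t = n" "Q' t" "X = cls t"
      using encodes_card[OF t] Q[OF t] cls[OF t] T by simp_all
    then show "X \<in> cls ` {t. nverts t = n \<and> Q' t}" by blast
  next
    fix X assume "X \<in> cls ` {t. nverts t = n \<and> Q' t}"
    then obtain t where t: "nverts t = n" "Q' t" "X = cls t" by auto
    obtain T :: "nat rooted_graph" where T: "encodes T t" using nat_graph_exists by blast
    then have "T \<in> {T \<in> rooted_trees n. Q T}"
      using t Q[OF T] encodes_card[OF T] encodes_rooted_tree[OF T] by (simp add: rooted_trees_def)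
    then show "X \<in> {T \<in> rooted_trees n. Q T} // rooted_iso_rel"
      unfolding t(3) cls[OF T, symmetric] by (rule quotientI)
  qed
  moreover have "inj cls"
  proof (rule injI)
    fix s t assume "cls s = cls t"
    moreover obtain T :: "nat rooted_graph" where T: "encodes T s" using nat_graph_exists by blast
    ultimately have "encodes T t" by (auto simp: cls_def)
    then show "s = t" using rooted_iso_iff_encodes_eq[OF T] rooted_iso_refl by blast
  qed
  ultimately show ?thesis
    using card_image[OF inj_on_subset[OF _ subset_UNIV]] by simp
qed

theorem mainTheorem5:
  fixes L :: "'a rooted_graph"
  assumes "rooted_tree L"
  shows "(\<lambda>n. real (num_rooted_trees_with_limb L n) / real (num_rooted_trees n))
           \<longlonglongrightarrow> 1"
proof -
  obtain l where l: "encodes L l" using encodes_exists[OF assms] .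
  have "num_rooted_trees_with_limb L n = card {t. nverts t = n \<and> l \<in> limbs t}" for n
    unfolding num_rooted_trees_with_limb_def
    by (intro card_quotient_rooted_iso has_maximal_limb_iff l)
  moreover have "num_rooted_trees n = card {t. nverts t = n}" for n
    using card_quotient_rooted_iso[of "\<lambda>_. True" "\<lambda>_. True" n]
    by (simp add: num_rooted_trees_def)
  ultimately show ?thesis
    using limb_proportion_tendsto_1[of l] by simp
qed

end
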